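(* In the free Carnot group $\mathbb{F}_{2,3}$ of rank two and step three, the Carnot-Carathéodory distance is not differentiable at $\exp(E)$ for any horizontal direction $E\in V_1$. Consequently, "maximality implies differentiability" fails in $\mathbb{F}_{2,3}$ for every horizontal direction, i.e. for every $E\in V_1$ with $\omega(E)=1$ there exist a Lipschitz map $f:\mathbb{F}_{2,3}\to\mathbb{R}$ and a point $x\in\mathbb{F}_{2,3}$ such that the directional derivative $Ef(x)$ exists and is maximal but $f$ is not differentiable at $x$.
   Context: A Carnot group $\mathbb{G}$ of step $s$ is a simply connected Lie group whose Lie algebra $\mathfrak g$ decomposes as $\mathfrak g=V_1\oplus\cdots\oplus V_s$ with $V_i=[V_1,V_{i-1}]$ for $i=2,\dots,s$ and $[V_1,V_s]=0$; $V_1$ is the horizontal layer, $r=\dim V_1$ the rank, and elements of $V_1$ are regarded as left-invariant vector fields. $\mathbb{F}_{2,3}$ is the Carnot group whose Lie algebra is the free-nilpotent Lie algebra of step $3$ on $2$ generators; $V_1$ is its horizontal layer (spanned by the generators). A basis $X_1,\dots,X_r$ of $V_1$ is fixed and $\omega$ is the inner product norm on $V_1$ making it orthonormal. An absolutely continuous curve $\gamma:[a,b]\to\mathbb{G}$ is horizontal if $\gamma'(t)=\sum_{j=1}^r u_j(t)X_j(\gamma(t))$ for a.e. $t$ with $u_j\in L^1[a,b]$; its length is $\int_a^b|u|$. The Carnot-Carathéodory (CC) distance $d(x,y)$ is the infimum of lengths of horizontal curves joining $x$ to $y$. "The CC distance is differentiable at a point" refers to the function $d:\mathbb{G}\to\mathbb{R}$,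 $d(x)=d(x,0)$, where $0$ denotes the identity. Lipschitz maps and $\mathrm{Lip}(f)$ are taken with respect to the metric $d$. Dilations: for $\lambda>0$, $\delta_\lambda(\exp(\sum_iY_i))=\exp(\sum_i\lambda^iY_i)$ for $Y_i\in V_i$. $L:\mathbb{G}\to\mathbb{R}$ is $\mathbb{G}$-linear if $L(xy)=L(x)+L(y)$ and $L(\delta_\lambda(x))=\lambda L(x)$ for all $x,y\in\mathbb{G}$, $\lambda>0$. A map $f:\mathbb{G}\to\mathbb{R}$ is (Pansu) differentiable at $x$ if there is a $\mathbb{G}$-linear $L$ with $\lim_{y\to x}|f(y)-f(x)-L(x^{-1}y)|/d(x,y)=0$. For $E\in V_1$, $Ef(x)=\lim_{t\to0}\frac{f(x\exp(tE))-f(x)}{t}$ when the limit exists. For Lipschitz $f$ and $\omega(E)=1$, the directional derivative $Ef(x)$ is maximal if $|Ef(x)|=\mathrm{Lip}(f)$. *)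

theory Defs
  imports "HOL-Analysis.Analysis"
begin

section \<open>The free-nilpotent Lie algebra of step 3 on two generators\<close>

lemma exhaust_5:
  fixes x :: 5
  shows "x = 1 \<or> x = 2 \<or> x = 3 \<or> x = 4 \<or> x = 5"
proof (induct x)
  case (of_int z)
  then have "z = 0 \<or> z = 1 \<or> z = 2 \<or> z = 3 \<or> z = 4" by auto
  then show ?case by auto
qed

lemma forall_5: "(\<forall>i::5. P i) \<longleftrightarrow> P 1 \<and> P 2 \<and> P 3 \<and> P 4 \<and> P 5"
  by (metis exhaust_5)

lemma vector_5 [simp]:
  "(vector [a, b, c, d, e] :: 'a::zero ^ 5) $ 1 = a"
  "(vector [a, b, c, d, e] :: 'a ^ 5) $ 2 = b"
  "(vector [a, b, c, d, e] :: 'a ^ 5) $ 3 = c"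
  "(vector [a, b, c, d, e] :: 'a ^ 5) $ 4 = d"
  "(vector [a, b, c, d, e] :: 'a ^ 5) $ 5 = e"
  by (simp_all add: vector_def)

definition is_lie_bracket :: "('a::real_vector \<Rightarrow> 'a \<Rightarrow> 'a) \<Rightarrow> bool" where
  "is_lie_bracket br \<longleftrightarrow>
     (\<forall>x. linear (br x)) \<and> (\<forall>y. linear (\<lambda>x. br x y)) \<and> (\<forall>x. br x x = 0) \<and>
     (\<forall>x y z. br x (br y z) + br y (br z x) + br z (br x y) = 0)"

definition nilpotent_step3 :: "('a::real_vector \<Rightarrow> 'a \<Rightarrow> 'a) \<Rightarrow> bool" where
  "nilpotent_step3 br \<longleftrightarrow> (\<forall>w x y z. br (br (br w x) y) z = 0)"

text \<open>The Lie algebra is realised on \<^typ>\<open>real^5\<close>, the coordinates being those with respect to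
  the Hall basis \<open>e\<^sub>1, e\<^sub>2, e\<^sub>3 = [e\<^sub>2,e\<^sub>1], e\<^sub>4 = [e\<^sub>3,e\<^sub>1], e\<^sub>5 = [e\<^sub>3,e\<^sub>2]\<close>, where \<open>e\<^sub>1, e\<^sub>2\<close> are
  the free generators.\<close>

definition f23_bracket :: "real^5 \<Rightarrow> real^5 \<Rightarrow> real^5" where
  "f23_bracket x y = vector [0, 0,
      x$2 * y$1 - x$1 * y$2,
      x$3 * y$1 - x$1 * y$3,
      x$3 * y$2 - x$2 * y$3]"

definition f23_V1 :: "(real^5) set" where
  "f23_V1 = span {axis 1 1, axis 2 1}"

definition f23_V2 :: "(real^5) set" where
  "f23_V2 = span {f23_bracket x y |x y. x \<in> f23_V1 \<and> y \<in> f23_V1}"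

definition f23_V3 :: "(real^5) set" where
  "f23_V3 = span {f23_bracket x y |x y. x \<in> f23_V1 \<and> y \<in> f23_V2}"

lemma f23_bracket_nth [simp]:
  "f23_bracket x y $ 1 = 0" "f23_bracket x y $ 2 = 0"
  "f23_bracket x y $ 3 = x$2 * y$1 - x$1 * y$2"
  "f23_bracket x y $ 4 = x$3 * y$1 - x$1 * y$3"
  "f23_bracket x y $ 5 = x$3 * y$2 - x$2 * y$3"
  unfolding f23_bracket_def vector_5 by (rule refl)+


section \<open>The group in exponential coordinates\<close>

text \<open>A Carnot group is diffeomorphic to its Lie algebra through the exponential map, so its
  elements are identified with \<^typ>\<open>real^5\<close> by exponential coordinates of the first kind. In these
  coordinates the product is the Baker-Campbell-Hausdorff series, whose terms of order four and
  higher vanish in step 3. The identity is \<open>0\<close> and the inverse of \<open>x\<close> is \<open>-x\<close>.\<close>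

definition f23_exp :: "real^5 \<Rightarrow> real^5" where
  "f23_exp Y = Y"

definition f23_mult :: "real^5 \<Rightarrow> real^5 \<Rightarrow> real^5" (infixl \<open>\<odot>\<close> 70) where
  "x \<odot> y = x + y + (1/2) *\<^sub>R f23_bracket x y
     + (1/12) *\<^sub>R f23_bracket x (f23_bracket x y)
     + (1/12) *\<^sub>R f23_bracket y (f23_bracket y x)"

definition f23_inv :: "real^5 \<Rightarrow> real^5" where
  "f23_inv x = - x"

text \<open>See \<open>f23_dilation_exp\<close> below for the description by layers.\<close>

definition f23_dilation :: "real \<Rightarrow> real^5 \<Rightarrow> real^5" where
  "f23_dilation l x = vector [l * x$1, l * x$2, l^2 * x$3, l^3 * x$4, l^3 * x$5]"

lemma f23_dilation_nth [simp]:
  "f23_dilation l x $ 1 = l * x$1" "f23_dilation l x $ 2 = l * x$2"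
  "f23_dilation l x $ 3 = l^2 * x$3" "f23_dilation l x $ 4 = l^3 * x$4"
  "f23_dilation l x $ 5 = l^3 * x$5"
  unfolding f23_dilation_def vector_5 by (rule refl)+

definition left_invariant_field :: "real^5 \<Rightarrow> real^5 \<Rightarrow> real^5" where
  "left_invariant_field Y p = vector_derivative (\<lambda>t. p \<odot> f23_exp (t *\<^sub>R Y)) (at 0)"


section \<open>The Carnot-Caratheodory distance\<close>

text \<open>The members of \<open>\<D>\<close> are finitely many non-overlapping compact intervals.\<close>

definition absolutely_continuous_curve ::
    "real \<Rightarrow> real \<Rightarrow> (real \<Rightarrow> 'a::real_normed_vector) \<Rightarrow> bool" where
  "absolutely_continuous_curve a b \<gamma> \<longleftrightarrow>
     (\<forall>\<epsilon>>0. \<exists>\<delta>>0. \<forall>\<D>. \<D> division_of \<Union>\<D> \<and> \<Union>\<D> \<subseteq> {a..b} \<and> (\<Sum>K\<in>\<D>. Sup K - Inf K) < \<delta>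
        \<longrightarrow> (\<Sum>K\<in>\<D>. norm (\<gamma> (Sup K) - \<gamma> (Inf K))) < \<epsilon>)"

text \<open>A basis \<open>X\<^sub>1, X\<^sub>2\<close> of the horizontal layer is a family indexed by the two-element type
  \<^typ>\<open>2\<close>; everything metric below depends on it.\<close>

definition horizontal_basis :: "(2 \<Rightarrow> real^5) \<Rightarrow> bool" where
  "horizontal_basis X \<longleftrightarrow> inj X \<and> independent (range X) \<and> span (range X) = f23_V1"

definition horizontal_norm :: "(2 \<Rightarrow> real^5) \<Rightarrow> real^5 \<Rightarrow> real" where
  "horizontal_norm X E = sqrt (\<Sum>j\<in>UNIV. (representation (range X) E (X j))\<^sup>2)"

definition horizontal_curve ::
    "(2 \<Rightarrow> real^5) \<Rightarrow> real \<Rightarrow> real \<Rightarrow> (real \<Rightarrow> real^5) \<Rightarrow> (real \<Rightarrow> real^2) \<Rightarrow> bool" where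
  "horizontal_curve X a b \<gamma> u \<longleftrightarrow>
     a < b \<and> absolutely_continuous_curve a b \<gamma> \<and>
     (\<forall>j. (\<lambda>t. u t $ j) absolutely_integrable_on {a..b}) \<and>
     (AE t in lebesgue_on {a..b}.
        (\<gamma> has_vector_derivative (\<Sum>j\<in>UNIV. u t $ j *\<^sub>R left_invariant_field (X j) (\<gamma> t)))
          (at t within {a..b}))"

text \<open>Any two points are joined by a horizontal curve (Chow's theorem), so that the real infimum is
  not one over the empty set.\<close>

definition cc_dist :: "(2 \<Rightarrow> real^5) \<Rightarrow> real^5 \<Rightarrow> real^5 \<Rightarrow> real" where
  "cc_dist X x y =
     Inf {integral {a..b} (\<lambda>t. norm (u t)) |a b \<gamma> u.
            horizontal_curve X a b \<gamma> u \<and> \<gamma> a = x \<and> \<gamma> b = y}"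

definition cc_lipschitz_with :: "(2 \<Rightarrow> real^5) \<Rightarrow> real \<Rightarrow> (real^5 \<Rightarrow> real) \<Rightarrow> bool" where
  "cc_lipschitz_with X C f \<longleftrightarrow> 0 \<le> C \<and> (\<forall>x y. \<bar>f x - f y\<bar> \<le> C * cc_dist X x y)"

definition cc_lipschitz :: "(2 \<Rightarrow> real^5) \<Rightarrow> (real^5 \<Rightarrow> real) \<Rightarrow> bool" where
  "cc_lipschitz X f \<longleftrightarrow> (\<exists>C. cc_lipschitz_with X C f)"

definition cc_Lip :: "(2 \<Rightarrow> real^5) \<Rightarrow> (real^5 \<Rightarrow> real) \<Rightarrow> real" where
  "cc_Lip X f = Inf {C. cc_lipschitz_with X C f}"


section \<open>Differentiability and directional derivatives\<close>

definition G_linear :: "(real^5 \<Rightarrow> real) \<Rightarrow> bool" where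
  "G_linear L \<longleftrightarrow> (\<forall>x y. L (x \<odot> y) = L x + L y) \<and> (\<forall>l>0. \<forall>x. L (f23_dilation l x) = l * L x)"

text \<open>The limit \<open>y \<rightarrow> x\<close> is taken in the manifold topology of the group, which in exponential
  coordinates is the Euclidean one (and coincides with the topology of the distance).\<close>

definition pansu_differentiable :: "(2 \<Rightarrow> real^5) \<Rightarrow> (real^5 \<Rightarrow> real) \<Rightarrow> real^5 \<Rightarrow> bool" where
  "pansu_differentiable X f x \<longleftrightarrow>
     (\<exists>L. G_linear L \<and>
        ((\<lambda>y. \<bar>f y - f x - L (f23_inv x \<odot> y)\<bar> / cc_dist X x y) \<longlongrightarrow> 0) (at x))"

definition has_directional_derivative ::
    "(real^5 \<Rightarrow> real) \<Rightarrow> real^5 \<Rightarrow> real^5 \<Rightarrow> real \<Rightarrow> bool" where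
  "has_directional_derivative f E x D \<longleftrightarrow>
     ((\<lambda>t. (f (x \<odot> f23_exp (t *\<^sub>R E)) - f x) / t) \<longlongrightarrow> D) (at 0)"

definition maximal_directional_derivative ::
    "(2 \<Rightarrow> real^5) \<Rightarrow> (real^5 \<Rightarrow> real) \<Rightarrow> real^5 \<Rightarrow> real^5 \<Rightarrow> bool" where
  "maximal_directional_derivative X f E x \<longleftrightarrow>
     (\<exists>D. has_directional_derivative f E x D \<and> \<bar>D\<bar> = cc_Lip X f)"


section \<open>Checks of the model\<close>

lemma f23_eqI:
  fixes x y :: "real^5"
  assumes "x$1 = y$1" "x$2 = y$2" "x$3 = y$3" "x$4 = y$4" "x$5 = y$5"
  shows "x = y"
  using assms by (simp only: vec_eq_iff forall_5)

lemma f23_is_lie_bracket: "is_lie_bracket f23_bracket"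
  unfolding is_lie_bracket_def
  by (intro conjI allI linearI f23_eqI;
      simp only: f23_bracket_nth vector_add_component vector_scaleR_component zero_index
        real_scaleR_def;
      simp add: algebra_simps)

lemma f23_nilpotent_step3: "nilpotent_step3 f23_bracket"
  unfolding nilpotent_step3_def
  by (intro allI f23_eqI; simp only: f23_bracket_nth zero_index; simp)

lemma f23_mult_nth:
  "(x \<odot> y) $ 1 = x$1 + y$1"
  "(x \<odot> y) $ 2 = x$2 + y$2"
  "(x \<odot> y) $ 3 = x$3 + y$3 + (x$2 * y$1 - x$1 * y$2) / 2"
  "(x \<odot> y) $ 4 = x$4 + y$4 + (x$3 * y$1 - x$1 * y$3) / 2
      + (y$1 - x$1) * (x$2 * y$1 - x$1 * y$2) / 12"
  "(x \<odot> y) $ 5 = x$5 + y$5 + (x$3 * y$2 - x$2 * y$3) / 2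
      + (y$2 - x$2) * (x$2 * y$1 - x$1 * y$2) / 12"
  unfolding f23_mult_def vector_add_component vector_scaleR_component f23_bracket_nth
  by (simp_all add: field_simps)

lemma f23_group:
  "(x \<odot> y) \<odot> z = x \<odot> (y \<odot> z)" "0 \<odot> x = x" "x \<odot> 0 = x"
  "f23_inv x \<odot> x = 0" "x \<odot> f23_inv x = 0"
  by (rule f23_eqI; simp only: f23_mult_nth f23_inv_def vector_uminus_component zero_index;
      simp add: field_simps)+

lemma f23_exp_one_parameter:
  "f23_exp (s *\<^sub>R Y) \<odot> f23_exp (t *\<^sub>R Y) = f23_exp ((s + t) *\<^sub>R Y)"
  by (rule f23_eqI;
      simp only: f23_mult_nth f23_exp_def vector_scaleR_component real_scaleR_def;
      simp add: field_simps)

lemma left_invariant_field_eq: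
  "left_invariant_field Y p =
     Y + (1/2) *\<^sub>R f23_bracket p Y + (1/12) *\<^sub>R f23_bracket p (f23_bracket p Y)" (is "_ = ?A")
  and has_vector_derivative_left_invariant_field:
  "((\<lambda>t. p \<odot> f23_exp (t *\<^sub>R Y)) has_vector_derivative left_invariant_field Y p) (at 0)"
proof -
  let ?B = "(1/12) *\<^sub>R f23_bracket Y (f23_bracket Y p)"
  have "(\<lambda>t. p \<odot> f23_exp (t *\<^sub>R Y)) = (\<lambda>t. p + t *\<^sub>R ?A + t^2 *\<^sub>R ?B)"
    by (intro ext f23_eqI; simp only: f23_mult_nth f23_exp_def vector_add_component
        vector_scaleR_component f23_bracket_nth real_scaleR_def; simp add: field_simps power2_eq_square)
  moreover have "((\<lambda>t. p + t *\<^sub>R ?A + t^2 *\<^sub>R ?B) has_vector_derivative ?A) (at 0)"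
    by (auto intro!: derivative_eq_intros)
  ultimately have *: "((\<lambda>t. p \<odot> f23_exp (t *\<^sub>R Y)) has_vector_derivative ?A) (at 0)"
    by simp
  then show "left_invariant_field Y p = ?A"
    unfolding left_invariant_field_def by (rule vector_derivative_at)
  with * show "((\<lambda>t. p \<odot> f23_exp (t *\<^sub>R Y)) has_vector_derivative left_invariant_field Y p) (at 0)"
    by simp
qed

lemma f23_dilation_mult:
  "f23_dilation l (x \<odot> y) = f23_dilation l x \<odot> f23_dilation l y"
  by (rule f23_eqI; simp only: f23_mult_nth f23_dilation_nth;
      simp add: field_simps power2_eq_square power3_eq_cube)

lemma f23_axis_nth [simp]:
  "(axis 1 1 :: real^5) $ 1 = 1" "(axis 1 1 :: real^5) $ 2 = 0" "(axis 1 1 :: real^5) $ 3 = 0"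
  "(axis 1 1 :: real^5) $ 4 = 0" "(axis 1 1 :: real^5) $ 5 = 0"
  "(axis 2 1 :: real^5) $ 1 = 0" "(axis 2 1 :: real^5) $ 2 = 1" "(axis 2 1 :: real^5) $ 3 = 0"
  "(axis 2 1 :: real^5) $ 4 = 0" "(axis 2 1 :: real^5) $ 5 = 0"
  by (simp_all add: axis_def)

lemma f23_V1_eq: "f23_V1 = {x. x$3 = 0 \<and> x$4 = 0 \<and> x$5 = 0}"
proof
  have "subspace {x::real^5. x$3 = 0 \<and> x$4 = 0 \<and> x$5 = 0}"
    by (intro subspaceI CollectI;
        simp only: vector_add_component vector_scaleR_component zero_index mem_Collect_eq; simp)
  then show "f23_V1 \<subseteq> {x. x$3 = 0 \<and> x$4 = 0 \<and> x$5 = 0}"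
    unfolding f23_V1_def by (rule span_minimal[rotated]) (simp del: One_nat_def)
next
  show "{x. x$3 = 0 \<and> x$4 = 0 \<and> x$5 = 0} \<subseteq> f23_V1"
  proof
    fix x :: "real^5"
    assume x: "x \<in> {x. x$3 = 0 \<and> x$4 = 0 \<and> x$5 = 0}"
    have "x = x$1 *\<^sub>R axis 1 1 + x$2 *\<^sub>R axis 2 1"
      using x by (intro f23_eqI;
        simp only: vector_add_component vector_scaleR_component f23_axis_nth mem_Collect_eq; simp)
    moreover have "x$1 *\<^sub>R axis 1 1 + x$2 *\<^sub>R axis 2 1 \<in> f23_V1"
      unfolding f23_V1_def by (intro span_add span_scale span_base) auto
    ultimately show "x \<in> f23_V1" by simp
  qed
qed

lemma f23_V2_eq: "f23_V2 = {x. x$1 = 0 \<and> x$2 = 0 \<and> x$4 = 0 \<and> x$5 = 0}"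
proof
  have "subspace {x::real^5. x$1 = 0 \<and> x$2 = 0 \<and> x$4 = 0 \<and> x$5 = 0}"
    by (intro subspaceI CollectI;
        simp only: vector_add_component vector_scaleR_component zero_index mem_Collect_eq; simp)
  moreover have "{f23_bracket x y |x y. x \<in> f23_V1 \<and> y \<in> f23_V1}
      \<subseteq> {x. x$1 = 0 \<and> x$2 = 0 \<and> x$4 = 0 \<and> x$5 = 0}"
    unfolding f23_V1_eq
    by (clarify; simp only: f23_bracket_nth; simp)
  ultimately show "f23_V2 \<subseteq> {x. x$1 = 0 \<and> x$2 = 0 \<and> x$4 = 0 \<and> x$5 = 0}"
    unfolding f23_V2_def by (intro span_minimal)
next
  show "{x. x$1 = 0 \<and> x$2 = 0 \<and> x$4 = 0 \<and> x$5 = 0} \<subseteq> f23_V2"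
  proof
    fix x :: "real^5"
    assume x: "x \<in> {x. x$1 = 0 \<and> x$2 = 0 \<and> x$4 = 0 \<and> x$5 = 0}"
    have "x = x$3 *\<^sub>R f23_bracket (axis 2 1) (axis 1 1)"
      using x by (intro f23_eqI; simp only: vector_scaleR_component f23_bracket_nth f23_axis_nth
        mem_Collect_eq; simp)
    moreover have "x$3 *\<^sub>R f23_bracket (axis 2 1) (axis 1 1) \<in> f23_V2"
      unfolding f23_V2_def
    proof (intro span_scale span_base CollectI exI conjI)
      show "axis 2 1 \<in> f23_V1" "axis 1 1 \<in> f23_V1"
        unfolding f23_V1_def by (auto intro: span_base)
    qed (rule refl)
    ultimately show "x \<in> f23_V2" by simp
  qed
qed

lemma f23_V3_eq: "f23_V3 = {x. x$1 = 0 \<and> x$2 = 0 \<and> x$3 = 0}"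
proof
  have "subspace {x::real^5. x$1 = 0 \<and> x$2 = 0 \<and> x$3 = 0}"
    by (intro subspaceI CollectI;
        simp only: vector_add_component vector_scaleR_component zero_index mem_Collect_eq; simp)
  moreover have "{f23_bracket x y |x y. x \<in> f23_V1 \<and> y \<in> f23_V2}
      \<subseteq> {x. x$1 = 0 \<and> x$2 = 0 \<and> x$3 = 0}"
    unfolding f23_V1_eq f23_V2_eq
    by (clarify; simp only: f23_bracket_nth; simp)
  ultimately show "f23_V3 \<subseteq> {x. x$1 = 0 \<and> x$2 = 0 \<and> x$3 = 0}"
    unfolding f23_V3_def by (intro span_minimal)
next
  show "{x. x$1 = 0 \<and> x$2 = 0 \<and> x$3 = 0} \<subseteq> f23_V3"
  proof
    fix x :: "real^5"
    assume x: "x \<in> {x. x$1 = 0 \<and> x$2 = 0 \<and> x$3 = 0}"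
    define c where "c = f23_bracket (axis 2 1) (axis 1 1)"
    have 1: "axis 1 1 \<in> f23_V1" and 2: "axis 2 1 \<in> f23_V1"
      unfolding f23_V1_def by (auto intro: span_base)
    then have c: "c \<in> f23_V2"
      unfolding f23_V2_def c_def by (auto intro!: span_base)
    have "x = (- x$4) *\<^sub>R f23_bracket (axis 1 1) c + (- x$5) *\<^sub>R f23_bracket (axis 2 1) c"
      using x unfolding c_def
      by (intro f23_eqI; simp only: vector_add_component vector_scaleR_component f23_bracket_nth
        f23_axis_nth mem_Collect_eq; simp)
    moreover have "\<dots> \<in> f23_V3"
      unfolding f23_V3_def using 1 2 c by (intro span_add span_scale span_base) blast+
    ultimately show "x \<in> f23_V3" by simp
  qed
qed

lemma f23_V1_V3: "x \<in> f23_V1 \<Longrightarrow> y \<in> f23_V3 \<Longrightarrow> f23_bracket x y = 0"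
  unfolding f23_V1_eq f23_V3_eq mem_Collect_eq
  by (intro f23_eqI; simp only: f23_bracket_nth zero_index; simp)

lemma f23_direct_sum:
  "\<exists>!(Y1, Y2, Y3). Y1 \<in> f23_V1 \<and> Y2 \<in> f23_V2 \<and> Y3 \<in> f23_V3 \<and> (x::real^5) = Y1 + Y2 + Y3"
proof -
  let ?P = "\<lambda>(Y1, Y2, Y3). Y1 \<in> f23_V1 \<and> Y2 \<in> f23_V2 \<and> Y3 \<in> f23_V3 \<and> x = Y1 + Y2 + Y3"
  let ?Y1 = "vector [x$1, x$2, 0, 0, 0] :: real^5"
  let ?Y2 = "vector [0, 0, x$3, 0, 0] :: real^5"
  let ?Y3 = "vector [0, 0, 0, x$4, x$5] :: real^5"
  have "?P (?Y1, ?Y2, ?Y3)"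
    unfolding f23_V1_eq f23_V2_eq f23_V3_eq mem_Collect_eq prod.case
    by (intro conjI f23_eqI; simp only: vector_5 vector_add_component; simp)
  moreover have "p = (?Y1, ?Y2, ?Y3)" if "?P p" for p
    using that unfolding f23_V1_eq f23_V2_eq f23_V3_eq mem_Collect_eq
    apply (cases p)
    apply (simp only: prod.case prod.inject)
    by (intro conjI f23_eqI; simp only: vector_5 vector_add_component; simp)
  ultimately show ?thesis by (rule ex1I[of ?P])
qed

lemma f23_dilation_exp:
  assumes "Y1 \<in> f23_V1" "Y2 \<in> f23_V2" "Y3 \<in> f23_V3"
  shows "f23_dilation l (f23_exp (Y1 + Y2 + Y3)) = f23_exp (l *\<^sub>R Y1 + l^2 *\<^sub>R Y2 + l^3 *\<^sub>R Y3)"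
  using assms unfolding f23_V1_eq f23_V2_eq f23_V3_eq mem_Collect_eq f23_exp_def
  by (intro f23_eqI;
      simp only: f23_dilation_nth vector_add_component vector_scaleR_component real_scaleR_def;
      simp)

text \<open>The universal property of the free-nilpotent Lie algebra.\<close>

theorem f23_universal:
  fixes br :: "'b::real_vector \<Rightarrow> 'b \<Rightarrow> 'b"
  assumes br: "is_lie_bracket br" and nil: "nilpotent_step3 br"
  shows "\<exists>!\<phi>. linear \<phi> \<and> (\<forall>x y. \<phi> (f23_bracket x y) = br (\<phi> x) (\<phi> y)) \<and>
           \<phi> (axis 1 1) = a \<and> \<phi> (axis 2 1) = b"
proof -
  have l1: "linear (br x)" and l2: "linear (\<lambda>x. br x y)" and sq: "br x x = 0"
    and jac: "br x (br y z) + br y (br z x) + br z (br x y) = 0" for x y z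
    using br unfolding is_lie_bracket_def by blast+
  note bil = linear_add[OF l1] linear_add[OF l2] linear_scale[OF l1] linear_scale[OF l2]
    linear_0[OF l1] linear_0[OF l2] linear_neg[OF l1] linear_neg[OF l2]
  have anti: "br x y = - br y x" for x y
  proof -
    have "br x x + br y x + (br x y + br y y) = 0"
      using sq[of "x + y"] by (simp only: bil)
    then show ?thesis by (simp add: sq eq_neg_iff_add_eq_0 add.commute)
  qed
  have n4: "br (br (br w x) y) z = 0" for w x y z
    using nil unfolding nilpotent_step3_def by blast
  have cc: "br (br x y) (br z w) = 0" for x y z w
  proof -
    have "br z (br w (br x y)) = 0"
      by (metis anti n4 bil(7) neg_equal_0_iff_equal)
    moreover have "br w (br (br x y) z) = 0"
      by (metis anti n4 neg_equal_0_iff_equal)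
    ultimately show ?thesis using jac[of "br x y" z w] by simp
  qed
  define c where "c = br b a"
  define d where "d = br c a"
  define e where "e = br c b"
  have tab: "br a a = 0" "br b b = 0" "br b a = c" "br a b = - c" "br c a = d" "br a c = - d"
    "br c b = e" "br b c = - e" "br c c = 0"
    unfolding c_def d_def e_def by (rule sq refl anti)+
  have right: "br d y = 0" "br e y = 0" if "y \<in> {a, b, c, d, e}" for y
    using that unfolding c_def d_def e_def by (auto simp: n4 cc)
  have left: "br y d = 0" "br y e = 0" if "y \<in> {a, b, c, d, e}" for y
    using anti[of y d] anti[of y e] right[OF that] by simp_all
  have tab2: "br d a = 0" "br d b = 0" "br d c = 0" "br d d = 0" "br d e = 0"
    "br e a = 0" "br e b = 0" "br e c = 0" "br e d = 0" "br e e = 0"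
    "br a d = 0" "br b d = 0" "br c d = 0" "br a e = 0" "br b e = 0" "br c e = 0"
    by (simp_all only: left right insert_iff simp_thms)
  let ?\<phi> = "\<lambda>x::real^5. x$1 *\<^sub>R a + x$2 *\<^sub>R b + x$3 *\<^sub>R c + x$4 *\<^sub>R d + x$5 *\<^sub>R e"
  show ?thesis
  proof (rule ex1I[of _ ?\<phi>])
    have "linear ?\<phi>"
      by (intro linearI; simp only: vector_add_component vector_scaleR_component;
          simp add: algebra_simps)
    moreover have "?\<phi> (f23_bracket x y) = br (?\<phi> x) (?\<phi> y)" for x y
      unfolding f23_bracket_nth by (simp add: bil tab tab2 algebra_simps)
    moreover have "?\<phi> (axis 1 1) = a" "?\<phi> (axis 2 1) = b"
      unfolding f23_axis_nth by simp_all
    ultimately show "linear ?\<phi> \<and> (\<forall>x y. ?\<phi> (f23_bracket x y) = br (?\<phi> x) (?\<phi> y)) \<and>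
        ?\<phi> (axis 1 1) = a \<and> ?\<phi> (axis 2 1) = b" by blast
  next
    fix \<psi> :: "real^5 \<Rightarrow> 'b"
    assume psi: "linear \<psi> \<and> (\<forall>x y. \<psi> (f23_bracket x y) = br (\<psi> x) (\<psi> y)) \<and>
        \<psi> (axis 1 1) = a \<and> \<psi> (axis 2 1) = b"
    then have lin: "linear \<psi>" and hom: "\<And>x y. \<psi> (f23_bracket x y) = br (\<psi> x) (\<psi> y)"
      and gen: "\<psi> (axis 1 1) = a" "\<psi> (axis 2 1) = b" by auto
    let ?c = "f23_bracket (axis 2 1) (axis 1 1)"
    show "\<psi> = ?\<phi>"
    proof
      fix x :: "real^5"
      have "x = x$1 *\<^sub>R axis 1 1 + x$2 *\<^sub>R axis 2 1 + x$3 *\<^sub>R ?c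
          + x$4 *\<^sub>R f23_bracket ?c (axis 1 1) + x$5 *\<^sub>R f23_bracket ?c (axis 2 1)"
        by (intro f23_eqI; simp only: vector_add_component vector_scaleR_component
          f23_bracket_nth f23_axis_nth; simp)
      then have "\<psi> x = \<psi> (x$1 *\<^sub>R axis 1 1 + x$2 *\<^sub>R axis 2 1 + x$3 *\<^sub>R ?c
          + x$4 *\<^sub>R f23_bracket ?c (axis 1 1) + x$5 *\<^sub>R f23_bracket ?c (axis 2 1))" by simp
      then show "\<psi> x = ?\<phi> x"
        by (simp only: linear_add[OF lin] linear_scale[OF lin] hom gen c_def d_def e_def)
    qed
  qed
qed

end

theory Submission
  imports Defs
begin

text \<open>Let \<open>E\<close> be a horizontal unit vector and \<open>s \<ge> 0\<close>. The distance of \<open>exp (s E)\<close> to the identity is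
  \<open>s\<close>. A third-layer element \<open>z\<^sub>t\<close> of the form \<open>\<delta>\<^sub>t z\<^sub>1\<close> has distance of order \<open>t\<close> to the identity, and
  every G-linear map vanishes on it. Differentiability at \<open>exp (s E)\<close> would thus force the
  distance to be \<open>s + o(t)\<close> at \<open>exp (s E) z\<^sub>t\<close>, whereas for a suitable \<open>z\<^sub>1\<close> it is at least \<open>s + c t\<close>
  (\<open>central_shift_excess_length\<close>).

  The reason is that the line \<open>t \<mapsto> exp (t E)\<close> is an abnormal curve. Split the horizontal coordinates into
  a component \<open>P\<close> along \<open>E\<close> and a component \<open>Q\<close> across it. There is a polynomial \<open>M\<close> on the group whose
  derivative along a horizontal curve is \<open>Q\<^sup>2 P'\<close>, and at \<open>exp (s E) z\<^sub>t\<close> it is a negative multiple of \<open>t\<^sup>3\<close>. A curve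
  from there to the identity has to decrease \<open>P\<close> by \<open>s\<close> and yet to increase \<open>M\<close>, which it can do only while
  it runs in the wrong direction and is off the line. If the length of the curve is \<open>s + \<delta>\<close>, at most
  \<open>\<delta> / 2\<close> of it is run in the wrong direction, so that the gain is at most \<open>h\<^sup>2 \<delta> / 2\<close>, where \<open>h\<close> is the largest
  value of \<open>\<bar>Q\<bar>\<close>. Since the curve ends with \<open>Q = 0\<close>, it also spends a length of order \<open>h\<close> at places with
  \<open>\<bar>Q\<bar> \<ge> h / 2\<close>. All of it but \<open>\<delta>\<close> is run in the right direction, which costs a multiple of \<open>h\<^sup>2 (h - \<delta>)\<close>. Hence
  \<open>h\<close> is at most of order \<open>\<delta>\<close>, the gain is \<open>O(\<delta>\<^sup>3)\<close> (\<open>turning_back_estimate\<close>), and \<open>\<delta>\<close> is at least of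
  order \<open>t\<close>.

  The distance to the identity is therefore itself the map asked for in the second claim: it is
  1-Lipschitz, and its derivative in direction \<open>E\<close> at \<open>exp E\<close> is 1.

  Three general facts carry the argument over to arbitrary horizontal curves: the fundamental theorem
  of calculus for absolutely continuous curves, the reversal and concatenation of horizontal curves (which
  make the distance symmetric and subadditive), and the existence of a horizontal curve between any two
  points, which is explicit here because third-layer elements are iterated group commutators.\<close>

section \<open>Absolutely continuous curves\<close>

lemma absolutely_continuous_curveD:
  assumes "absolutely_continuous_curve a b f" "0 < e"
  shows "\<exists>d>0. \<forall>\<D>. \<D> division_of \<Union>\<D> \<longrightarrow> \<Union>\<D> \<subseteq> {a..b} \<longrightarrow> (\<Sum>K\<in>\<D>. Sup K - Inf K) < d
        \<longrightarrow> (\<Sum>K\<in>\<D>. norm (f (Sup K) - f (Inf K))) < e"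
  using assms unfolding absolutely_continuous_curve_def imp_conjL by blast

lemma absolutely_continuous_curve_subinterval:
  assumes "absolutely_continuous_curve a b f" "a \<le> c" "d \<le> b"
  shows "absolutely_continuous_curve c d f"
proof -
  have "{c..d} \<subseteq> {a..b}"
    using assms by auto
  with assms(1) show ?thesis
    unfolding absolutely_continuous_curve_def by (meson subset_trans)
qed

lemma division_real_interval:
  assumes "\<D> division_of S" "K \<in> \<D>"
  obtains u v :: real where "K = {u..v}" "u \<le> v" "Inf K = u" "Sup K = v"
proof -
  obtain u v where "K = cbox u v" "K \<noteq> {}"
    using division_ofD(3,4)[OF assms] by blast
  then have "K = {u..v}" "u \<le> v" by auto
  then show thesis using that by simp
qed

text \<open>The rules for Lipschitz functions, sums, linear images and products below are instances of this
  domination principle.\<close>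
lemma absolutely_continuous_curve_dominated:
  assumes f: "absolutely_continuous_curve a b f" and g: "absolutely_continuous_curve a b g"
    and dom: "\<And>s t. \<lbrakk>a \<le> s; s \<le> t; t \<le> b\<rbrakk>
      \<Longrightarrow> norm (h t - h s) \<le> B * (norm (f t - f s) + norm (g t - g s))"
  shows "absolutely_continuous_curve a b h"
  unfolding absolutely_continuous_curve_def
proof (intro allI impI)
  fix e :: real assume "0 < e"
  define B' where "B' = \<bar>B\<bar> + 1"
  have B': "0 < B'" "B \<le> B'" by (auto simp: B'_def)
  define e' where "e' = e / (2 * B')"
  have "0 < e'" using \<open>0 < e\<close> B' by (simp add: e'_def)
  obtain d1 where d1: "0 < d1"
    "\<forall>\<D>. \<D> division_of \<Union>\<D> \<longrightarrow> \<Union>\<D> \<subseteq> {a..b} \<longrightarrow> (\<Sum>K\<in>\<D>. Sup K - Inf K) < d1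
       \<longrightarrow> (\<Sum>K\<in>\<D>. norm (f (Sup K) - f (Inf K))) < e'"
    using absolutely_continuous_curveD[OF f \<open>0 < e'\<close>] by auto
  obtain d2 where d2: "0 < d2"
    "\<forall>\<D>. \<D> division_of \<Union>\<D> \<longrightarrow> \<Union>\<D> \<subseteq> {a..b} \<longrightarrow> (\<Sum>K\<in>\<D>. Sup K - Inf K) < d2
       \<longrightarrow> (\<Sum>K\<in>\<D>. norm (g (Sup K) - g (Inf K))) < e'"
    using absolutely_continuous_curveD[OF g \<open>0 < e'\<close>] by auto
  show "\<exists>d>0. \<forall>\<D>. \<D> division_of \<Union>\<D> \<and> \<Union>\<D> \<subseteq> {a..b} \<and> (\<Sum>K\<in>\<D>. Sup K - Inf K) < d
        \<longrightarrow> (\<Sum>K\<in>\<D>. norm (h (Sup K) - h (Inf K))) < e"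
  proof (intro exI conjI allI impI)
    show "0 < min d1 d2" using d1(1) d2(1) by simp
    fix \<D> :: "real set set"
    assume D: "\<D> division_of \<Union>\<D> \<and> \<Union>\<D> \<subseteq> {a..b} \<and> (\<Sum>K\<in>\<D>. Sup K - Inf K) < min d1 d2"
    have "(\<Sum>K\<in>\<D>. norm (h (Sup K) - h (Inf K)))
        \<le> (\<Sum>K\<in>\<D>. B' * (norm (f (Sup K) - f (Inf K)) + norm (g (Sup K) - g (Inf K))))"
    proof (rule sum_mono)
      fix K assume K: "K \<in> \<D>"
      obtain u v where uv: "K = {u..v}" "u \<le> v" "Inf K = u" "Sup K = v"
        using division_real_interval D K by metis
      have "{u..v} \<subseteq> {a..b}" using D K uv(1) by blast
      with uv(2) have "a \<le> u" "v \<le> b" by auto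
      then have "norm (h v - h u) \<le> B * (norm (f v - f u) + norm (g v - g u))"
        using dom uv(2) by blast
      also have "\<dots> \<le> B' * (norm (f v - f u) + norm (g v - g u))"
        by (intro mult_right_mono B') simp
      finally show "norm (h (Sup K) - h (Inf K))
          \<le> B' * (norm (f (Sup K) - f (Inf K)) + norm (g (Sup K) - g (Inf K)))"
        by (simp add: uv)
    qed
    also have "\<dots> = B' * ((\<Sum>K\<in>\<D>. norm (f (Sup K) - f (Inf K))) + (\<Sum>K\<in>\<D>. norm (g (Sup K) - g (Inf K))))"
      by (simp add: sum_distrib_left distrib_left flip: sum.distrib)
    also have "\<dots> < B' * (e' + e')"
      using d1(2)[rule_format, of \<D>] d2(2)[rule_format, of \<D>] D B' by (intro mult_strict_left_mono add_strict_mono) auto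
    also have "\<dots> = e" using B' by (simp add: e'_def)
    finally show "(\<Sum>K\<in>\<D>. norm (h (Sup K) - h (Inf K))) < e" .
  qed
qed

lemma absolutely_continuous_curve_ident: "absolutely_continuous_curve a b (\<lambda>t::real. t)"
  unfolding absolutely_continuous_curve_def
proof (intro allI impI)
  fix e :: real assume "0 < e"
  moreover have "(\<Sum>K\<in>\<D>. norm (Sup K - Inf K)) = (\<Sum>K\<in>\<D>. Sup K - Inf K)"
    if div: "\<D> division_of \<Union>\<D>" for \<D> :: "real set set"
  proof (rule sum.cong[OF refl])
    fix K assume "K \<in> \<D>"
    then obtain u v where "u \<le> v" "Inf K = u" "Sup K = v"
      using division_real_interval[OF div] by metis
    then show "norm (Sup K - Inf K) = Sup K - Inf K" by simp
  qed
  ultimately show "\<exists>d>0. \<forall>\<D>. \<D> division_of \<Union>\<D> \<and> \<Union>\<D> \<subseteq> {a..b} \<and> (\<Sum>K\<in>\<D>. Sup K - Inf K) < d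
        \<longrightarrow> (\<Sum>K\<in>\<D>. norm (Sup K - Inf K)) < e"
    by metis
qed

lemma absolutely_continuous_curve_Lipschitz:
  assumes "\<And>s t. \<lbrakk>a \<le> s; s \<le> t; t \<le> b\<rbrakk> \<Longrightarrow> norm (h t - h s) \<le> B * (t - s)"
  shows "absolutely_continuous_curve a b h"
proof (rule absolutely_continuous_curve_dominated[OF
      absolutely_continuous_curve_ident absolutely_continuous_curve_ident])
  fix s t assume "a \<le> s" "s \<le> t" "t \<le> b"
  then show "norm (h t - h s) \<le> B / 2 * (norm (t - s) + norm (t - s))"
    using assms[of s t] by (simp add: field_simps)
qed

lemma absolutely_continuous_curve_const: "absolutely_continuous_curve a b (\<lambda>_. c)"
  by (rule absolutely_continuous_curve_Lipschitz[where B = 0]) simp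

lemma absolutely_continuous_curve_add:
  assumes "absolutely_continuous_curve a b f" "absolutely_continuous_curve a b g"
  shows "absolutely_continuous_curve a b (\<lambda>t. f t + g t)"
  by (rule absolutely_continuous_curve_dominated[OF assms, where B = 1])
    (simp add: add_diff_add norm_triangle_ineq)

lemma absolutely_continuous_curve_linear:
  assumes "bounded_linear T" and f: "absolutely_continuous_curve a b f"
  shows "absolutely_continuous_curve a b (\<lambda>t. T (f t))"
proof -
  interpret bounded_linear T by fact
  obtain B where B: "\<And>x. norm (T x) \<le> norm x * B" "0 \<le> B"
    using nonneg_bounded by blast
  show ?thesis
  proof (rule absolutely_continuous_curve_dominated[OF f f])
    fix s t
    show "norm (T (f t) - T (f s)) \<le> B * (norm (f t - f s) + norm (f t - f s))"
      using B(1)[of "f t - f s"] mult_nonneg_nonneg[OF B(2) norm_ge_zero[of "f t - f s"]]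
      by (simp add: diff mult.commute distrib_left)
  qed
qed

lemma absolutely_continuous_curve_imp_continuous_on:
  assumes f: "absolutely_continuous_curve a b f"
  shows "continuous_on {a..b} f"
  unfolding continuous_on_iff
proof (intro ballI allI impI)
  fix x e :: real assume x: "x \<in> {a..b}" and "0 < e"
  obtain d where d: "0 < d"
    "\<forall>\<D>. \<D> division_of \<Union>\<D> \<longrightarrow> \<Union>\<D> \<subseteq> {a..b} \<longrightarrow> (\<Sum>K\<in>\<D>. Sup K - Inf K) < d
       \<longrightarrow> (\<Sum>K\<in>\<D>. norm (f (Sup K) - f (Inf K))) < e"
    using absolutely_continuous_curveD[OF f \<open>0 < e\<close>] by auto
  have *: "norm (f v - f u) < e" if "u \<in> {a..b}" "v \<in> {a..b}" "u \<le> v" "v - u < d" for u v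
  proof -
    have "{{u..v}} division_of \<Union>{{u..v}}"
      using that(3) division_of_self[of u v] by (simp add: box_real)
    from d(2)[rule_format, OF this] show ?thesis using that by auto
  qed
  show "\<exists>d>0. \<forall>x'\<in>{a..b}. dist x' x < d \<longrightarrow> dist (f x') (f x) < e"
  proof (intro exI conjI ballI impI)
    fix x' assume "x' \<in> {a..b}" "dist x' x < d"
    then show "dist (f x') (f x) < e"
      using *[of x x'] *[of x' x] x
      by (cases "x \<le> x'") (auto simp: dist_norm norm_minus_commute)
  qed (rule d(1))
qed

lemma absolutely_continuous_curve_mult:
  fixes f g :: "real \<Rightarrow> real"
  assumes f: "absolutely_continuous_curve a b f" and g: "absolutely_continuous_curve a b g"
  shows "absolutely_continuous_curve a b (\<lambda>t. f t * g t)"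
proof -
  have "bounded (f ` {a..b} \<union> g ` {a..b})"
    by (intro bounded_Un[THEN iffD2] conjI compact_imp_bounded compact_continuous_image
        absolutely_continuous_curve_imp_continuous_on f g) auto
  then obtain B where B: "\<And>x. x \<in> f ` {a..b} \<union> g ` {a..b} \<Longrightarrow> norm x \<le> B"
    unfolding bounded_iff by blast
  show ?thesis
  proof (rule absolutely_continuous_curve_dominated[OF f g])
    fix s t assume st: "a \<le> s" "s \<le> t" "t \<le> b"
    have "f t * g t - f s * g s = g t * (f t - f s) + f s * (g t - g s)"
      by (simp add: algebra_simps)
    then have "norm (f t * g t - f s * g s) \<le> norm (g t) * norm (f t - f s) + norm (f s) * norm (g t - g s)"
      by (metis norm_mult norm_triangle_ineq)
    also have "\<dots> \<le> B * norm (f t - f s) + B * norm (g t - g s)"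
      using st B[of "g t"] B[of "f s"] by (intro add_mono mult_right_mono) auto
    finally show "norm (f t * g t - f s * g s) \<le> B * (norm (f t - f s) + norm (g t - g s))"
      by (simp add: distrib_left)
  qed
qed

text \<open>This covers translation and reflection of the parameter as well as the clamps \<open>min t b\<close> and
  \<open>max t b\<close>, by means of which concatenated curves become sums. The map \<open>r\<close> may collapse intervals to
  points; these contribute nothing and are discarded, since several of them can have the same image.\<close>
lemma absolutely_continuous_curve_reparam:
  fixes r :: "real \<Rightarrow> real"
  assumes f: "absolutely_continuous_curve a b f"
    and range: "\<And>t. t \<in> {c..d} \<Longrightarrow> r t \<in> {a..b}"
    and lip: "\<And>s t. \<lbrakk>s \<in> {c..d}; t \<in> {c..d}\<rbrakk> \<Longrightarrow> \<bar>r t - r s\<bar> \<le> \<bar>t - s\<bar>"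
    and mono: "mono_on {c..d} r \<or> antimono_on {c..d} r"
  shows "absolutely_continuous_curve c d (\<lambda>t. f (r t))"
  unfolding absolutely_continuous_curve_def
proof (intro allI impI)
  fix e :: real assume "0 < e"
  obtain \<delta> where \<delta>: "0 < \<delta>"
    "\<forall>\<D>. \<D> division_of \<Union>\<D> \<longrightarrow> \<Union>\<D> \<subseteq> {a..b} \<longrightarrow> (\<Sum>K\<in>\<D>. Sup K - Inf K) < \<delta>
       \<longrightarrow> (\<Sum>K\<in>\<D>. norm (f (Sup K) - f (Inf K))) < e"
    using absolutely_continuous_curveD[OF f \<open>0 < e\<close>] by auto
  show "\<exists>\<delta>>0. \<forall>\<D>. \<D> division_of \<Union>\<D> \<and> \<Union>\<D> \<subseteq> {c..d} \<and> (\<Sum>K\<in>\<D>. Sup K - Inf K) < \<delta>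
        \<longrightarrow> (\<Sum>K\<in>\<D>. norm (f (r (Sup K)) - f (r (Inf K)))) < e"
  proof (intro exI conjI allI impI)
    fix \<D> :: "real set set"
    assume D: "\<D> division_of \<Union>\<D> \<and> \<Union>\<D> \<subseteq> {c..d} \<and> (\<Sum>K\<in>\<D>. Sup K - Inf K) < \<delta>"
    define \<D>' where "\<D>' = {K \<in> \<D>. r (Inf K) \<noteq> r (Sup K)}"
    define lo hi where "lo K = min (r (Inf K)) (r (Sup K))"
      and "hi K = max (r (Inf K)) (r (Sup K))" for K
    define I where "I K = {lo K..hi K}" for K
    have divD: "\<D> division_of \<Union>\<D>" using D by simp
    have fin: "finite \<D>" by (rule division_ofD(1)[OF divD])
    have K: "\<exists>u v. K = {u..v} \<and> u \<le> v \<and> Inf K = u \<and> Sup K = v \<and> u \<in> {c..d} \<and> v \<in> {c..d}"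
      if KD: "K \<in> \<D>" for K
    proof -
      obtain u v where uv: "K = {u..v}" "u \<le> v" "Inf K = u" "Sup K = v"
        using division_real_interval[OF divD KD] by metis
      moreover have "{u..v} \<subseteq> {c..d}" using D KD uv(1) by blast
      ultimately show ?thesis by force
    qed
    have le: "Inf K \<le> Sup K" and mem: "Inf K \<in> {c..d}" "Sup K \<in> {c..d}" if "K \<in> \<D>" for K
      using K[OF that] by metis+
    have lohi: "lo K < hi K" if "K \<in> \<D>'" for K
      using that by (auto simp: \<D>'_def lo_def hi_def)
    have nd: "Inf K < Sup K" if "K \<in> \<D>'" for K
    proof -
      have "Inf K \<noteq> Sup K" "K \<in> \<D>" using that by (auto simp: \<D>'_def)
      with le[of K] show ?thesis by simp
    qed
    \<comment> \<open>Non-overlapping intervals stay in order, or all change order, under a monotone map.\<close>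
    have ord: "hi K \<le> lo L \<or> hi L \<le> lo K" if "K \<in> \<D>'" "L \<in> \<D>'" "K \<noteq> L" for K L
    proof -
      have KL: "K \<in> \<D>" "L \<in> \<D>" using that by (auto simp: \<D>'_def)
      obtain u v where uv: "K = {u..v}" "Inf K = u" "Sup K = v" "u \<in> {c..d}" "v \<in> {c..d}"
        using K[OF KL(1)] by blast
      obtain w z where wz: "L = {w..z}" "Inf L = w" "Sup L = z" "w \<in> {c..d}" "z \<in> {c..d}"
        using K[OF KL(2)] by blast
      have lt: "u < v" "w < z" using nd[OF that(1)] nd[OF that(2)] uv(2,3) wz(2,3) by simp_all
      have "interior K \<inter> interior L = {}"
        by (rule division_ofD(5)[OF divD KL \<open>K \<noteq> L\<close>])
      then have "{max u w<..<min v z} = {}"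
        by (auto simp: uv(1) wz(1) interior_atLeastAtMost_real)
      then have "min v z \<le> max u w" by (simp add: greaterThanLessThan_empty_iff)
      then have "v \<le> w \<or> z \<le> u" using lt by (auto simp: min_def max_def split: if_splits)
      then show ?thesis
        using mono lt uv(2-) wz(2-) unfolding lo_def hi_def monotone_on_def
        by (smt (verit))
    qed
    have inj: "inj_on I \<D>'"
    proof (rule inj_onI, rule ccontr)
      fix K L assume KL: "K \<in> \<D>'" "L \<in> \<D>'" "I K = I L" "K \<noteq> L"
      then have "lo K = lo L" "hi K = hi L"
        using lohi[OF KL(1)] lohi[OF KL(2)] KL(3) by (auto simp: I_def Icc_eq_Icc)
      then show False using ord[OF KL(1,2,4)] lohi[OF KL(1)] by auto
    qed
    have div: "(I ` \<D>') division_of \<Union>(I ` \<D>')"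
    proof (rule division_ofI)
      show "finite (I ` \<D>')" using fin by (simp add: \<D>'_def)
      fix J assume J: "J \<in> I ` \<D>'"
      then show "J \<subseteq> \<Union>(I ` \<D>')" by blast
      show "J \<noteq> {}" using J lohi by (force simp: I_def)
      obtain L where "J = cbox (lo L) (hi L)" using J by (auto simp: I_def)
      then show "\<exists>x y. J = cbox x y" by blast
      fix J' assume J': "J' \<in> I ` \<D>'" "J \<noteq> J'"
      obtain K L where KL: "K \<in> \<D>'" "L \<in> \<D>'" "J = I K" "J' = I L" "K \<noteq> L"
        using J J' by blast
      show "interior J \<inter> interior J' = {}"
        using ord[OF KL(1,2,5)] by (auto simp: KL(3,4) I_def interior_atLeastAtMost_real)
    qed simp
    have SI: "Sup (I K) = hi K" "Inf (I K) = lo K" if "K \<in> \<D>'" for K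
      using lohi[OF that] by (simp_all add: I_def)
    have "(\<Sum>J\<in>I ` \<D>'. Sup J - Inf J) = (\<Sum>K\<in>\<D>'. hi K - lo K)"
      by (simp add: sum.reindex[OF inj] SI)
    also have "\<dots> \<le> (\<Sum>K\<in>\<D>'. Sup K - Inf K)"
    proof (rule sum_mono)
      fix L assume "L \<in> \<D>'"
      then show "hi L - lo L \<le> Sup L - Inf L"
        using le[of L] mem[of L] lip[of "Inf L" "Sup L"] by (simp add: \<D>'_def lo_def hi_def)
    qed
    also have "\<dots> \<le> (\<Sum>K\<in>\<D>. Sup K - Inf K)"
      by (rule sum_mono2[OF fin]) (simp_all add: \<D>'_def le)
    also have "\<dots> < \<delta>" using D by simp
    finally have small: "(\<Sum>J\<in>I ` \<D>'. Sup J - Inf J) < \<delta>" .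
    have sub: "\<Union>(I ` \<D>') \<subseteq> {a..b}"
    proof
      fix x assume "x \<in> \<Union>(I ` \<D>')"
      then obtain L where L: "L \<in> \<D>'" "lo L \<le> x" "x \<le> hi L"
        by (auto simp: I_def)
      then have "L \<in> \<D>" by (simp add: \<D>'_def)
      then have "r (Inf L) \<in> {a..b}" "r (Sup L) \<in> {a..b}"
        using mem range by blast+
      then show "x \<in> {a..b}" using L by (auto simp: lo_def hi_def)
    qed
    have "(\<Sum>K\<in>\<D>. norm (f (r (Sup K)) - f (r (Inf K)))) = (\<Sum>K\<in>\<D>'. norm (f (r (Sup K)) - f (r (Inf K))))"
      by (rule sum.mono_neutral_right[OF fin]) (auto simp: \<D>'_def)
    also have "\<dots> = (\<Sum>K\<in>\<D>'. norm (f (hi K) - f (lo K)))"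
      by (intro sum.cong refl) (auto simp: lo_def hi_def max_def min_def norm_minus_commute)
    also have "\<dots> = (\<Sum>J\<in>I ` \<D>'. norm (f (Sup J) - f (Inf J)))"
      by (simp add: sum.reindex[OF inj] SI)
    also have "\<dots> < e"
      by (rule \<delta>(2)[rule_format, OF div sub small])
    finally show "(\<Sum>K\<in>\<D>. norm (f (r (Sup K)) - f (r (Inf K)))) < e" .
  qed (rule \<delta>(1))
qed

text \<open>The gauge integral admits a direct proof. Tags outside the exceptional set \<open>S\<close> are treated as in the
  classical theorem. Around tags in \<open>S\<close> the gauge keeps the intervals inside an open set of small
  measure, so that absolute continuity bounds the total variation over them.\<close>
theorem absolutely_continuous_curve_FTC:
  fixes f :: "real \<Rightarrow> 'a::banach"
  assumes "a \<le> b" and f: "absolutely_continuous_curve a b f" and S: "negligible S"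
    and deriv: "\<And>t. t \<in> {a..b} - S \<Longrightarrow> (f has_vector_derivative g t) (at t within {a..b})"
  shows "(g has_integral (f b - f a)) {a..b}"
proof (rule has_integral_spike[OF S])
  show "((\<lambda>t. if t \<in> S then 0 else g t) has_integral (f b - f a)) {a..b}"
    unfolding has_integral_real
  proof (intro allI impI)
    fix e :: real assume "0 < e"
    define c where "c = e / (2 * (b - a + 1))"
    have c: "0 < c" "c * (b - a) < e / 2"
      using \<open>a \<le> b\<close> \<open>0 < e\<close> by (auto simp: c_def field_simps intro!: mult_pos_pos)
    have "\<forall>x. \<exists>d>0. x \<in> {a..b} - S \<longrightarrow>
         (\<forall>y\<in>{a..b}. norm (y-x) < d \<longrightarrow> norm (f y - f x - (y-x) *\<^sub>R g x) \<le> c * norm (y-x))"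
      using deriv[unfolded has_vector_derivative_def has_derivative_within_alt] c(1) by (metis zero_less_one)
    then obtain d where d: "\<And>x. 0 < d x"
      "\<And>x y. \<lbrakk>x \<in> {a..b} - S; y \<in> {a..b}; norm (y-x) < d x\<rbrakk>
         \<Longrightarrow> norm (f y - f x - (y-x) *\<^sub>R g x) \<le> c * norm (y-x)"
      by metis
    obtain \<delta> where \<delta>: "0 < \<delta>"
      "\<forall>\<D>. \<D> division_of \<Union>\<D> \<longrightarrow> \<Union>\<D> \<subseteq> {a..b} \<longrightarrow> (\<Sum>K\<in>\<D>. Sup K - Inf K) < \<delta>
       \<longrightarrow> (\<Sum>K\<in>\<D>. norm (f (Sup K) - f (Inf K))) < e / 2"
    using absolutely_continuous_curveD[OF f, of "e / 2"] \<open>0 < e\<close> by auto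
    have S0: "S \<in> null_sets lebesgue" using S by (simp add: negligible_iff_null_sets)
    obtain U where U: "open U" "S \<subseteq> U" "U - S \<in> lmeasurable" "emeasure lebesgue (U - S) < ennreal \<delta>"
      using sets_lebesgue_outer_open[of S \<delta>] S0 \<open>0 < \<delta>\<close> by (metis null_setsD2)
    have U': "U \<in> lmeasurable" "measure lebesgue U < \<delta>"
    proof -
      have Ueq: "U = S \<union> (U - S)" using U(2) by blast
      have "S \<in> lmeasurable" using S by (rule negligible_imp_measurable)
      then show "U \<in> lmeasurable" using U(3) Ueq by (metis fmeasurable.Un)
      have "measure lebesgue U = measure lebesgue (U - S)"
        by (metis Ueq U(3) S0 fmeasurableD measure_Un_null_set sup_commute)
      also have "\<dots> < \<delta>"
        using U(3,4) by (metis emeasure_eq_measure2 ennreal_less_iff measure_nonneg)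
      finally show "measure lebesgue U < \<delta>" .
    qed
    define \<gamma> where "\<gamma> x = (if x \<in> S then U else ball x (d x))" for x
    have gauge: "gauge \<gamma>" using d(1) U(1,2) by (auto simp: gauge_def \<gamma>_def)
    have main: "norm ((\<Sum>(x, k)\<in>p. Henstock_Kurzweil_Integration.content k *\<^sub>R (if x \<in> S then 0 else g x)) - (f b - f a)) < e"
      if p: "p tagged_division_of {a..b}" and fine: "\<gamma> fine p" for p
    proof -
      have finp: "finite p" using p by blast
      have xK: "\<exists>u v. K = {u..v} \<and> u \<le> v \<and> x \<in> {u..v} \<and> a \<le> u \<and> v \<le> b \<and> K \<subseteq> \<gamma> x" if xKp: "(x, K) \<in> p" for x K
      proof -
        obtain u v where K: "K = cbox u v" "x \<in> K" "K \<subseteq> {a..b}"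
          using tagged_division_ofD(2,3,4)[OF p xKp] by metis
        moreover have "K \<subseteq> \<gamma> x" using fine xKp by (auto simp: fine_def)
        ultimately show ?thesis by (intro exI[of _ u] exI[of _ v]) auto
      qed
      define bad where "bad = {(x, K) \<in> p. x \<in> S}"
      define F where "F = (\<lambda>(x, K). Henstock_Kurzweil_Integration.content K *\<^sub>R (if x \<in> S then 0 else g x) - (f (Sup K) - f (Inf K)))"
      have "(\<Sum>(x, k)\<in>p. Henstock_Kurzweil_Integration.content k *\<^sub>R (if x \<in> S then 0 else g x)) - (f b - f a) = sum F p"
        using additive_tagged_division_1[OF \<open>a \<le> b\<close> p, of f]
        by (simp add: F_def split_def sum_subtractf)
      also have "\<dots> = sum F bad + sum F (p - bad)"
        by (rule sum.subset_diff[OF _ finp, THEN trans]) (auto simp: bad_def add.commute)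
      finally have split: "(\<Sum>(x, k)\<in>p. Henstock_Kurzweil_Integration.content k *\<^sub>R (if x \<in> S then 0 else g x)) - (f b - f a)
        = sum F bad + sum F (p - bad)" .
      have "norm (sum F (p - bad)) \<le> (\<Sum>(x,K)\<in>p - bad. c * (Sup K - Inf K))"
      proof (rule sum_norm_le, clarify)
        fix x K assume "(x, K) \<in> p" "(x, K) \<notin> bad"
        then have "x \<notin> S" by (auto simp: bad_def)
        obtain u v where K: "K = {u..v}" "u \<le> v" "x \<in> {u..v}" "a \<le> u" "v \<le> b" "K \<subseteq> ball x (d x)"
          using xK[OF \<open>(x, K) \<in> p\<close>] \<open>x \<notin> S\<close> by (auto simp: \<gamma>_def)
        have "u \<in> K" "v \<in> K" using K by auto
        then have "norm (u - x) < d x" "norm (v - x) < d x"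
          using K(6) by (auto simp: dist_norm subset_iff norm_minus_commute)
        then have *: "norm (f u - f x - (u - x) *\<^sub>R g x) \<le> c * norm (u - x)"
          "norm (f v - f x - (v - x) *\<^sub>R g x) \<le> c * norm (v - x)"
          by (intro d(2); use K \<open>x \<notin> S\<close> in simp)+
        have "F (x, K) = (f u - f x - (u - x) *\<^sub>R g x) - (f v - f x - (v - x) *\<^sub>R g x)"
          using K(1,2) \<open>x \<notin> S\<close> by (simp add: F_def algebra_simps)
        then have "norm (F (x, K)) \<le> norm (f u - f x - (u - x) *\<^sub>R g x) + norm (f v - f x - (v - x) *\<^sub>R g x)"
          by (metis norm_triangle_ineq4)
        also have "\<dots> \<le> c * norm (u - x) + c * norm (v - x)" using * by linarith
        also have "\<dots> = c * (Sup K - Inf K)" using K(1,2,3) by (simp add: algebra_simps)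
        finally show "norm (F (x, K)) \<le> c * (Sup K - Inf K)" .
      qed
      also have "\<dots> \<le> (\<Sum>(x,K)\<in>p. c * (Sup K - Inf K))"
      proof (rule sum_mono2[OF finp])
        fix z assume "z \<in> p - (p - bad)"
        then obtain x K where z: "z = (x, K)" "(x, K) \<in> p" by (cases z) auto
        obtain u v where "K = {u..v}" "u \<le> v" using xK[OF z(2)] by blast
        then show "0 \<le> (case z of (x, K) \<Rightarrow> c * (Sup K - Inf K))"
          using c(1) by (simp add: z(1))
      qed blast
      also have "\<dots> = c * (b - a)"
        using additive_tagged_division_1[OF \<open>a \<le> b\<close> p, of "\<lambda>x. x"]
        by (simp add: split_def sum_distrib_left[symmetric])
      finally have good: "norm (sum F (p - bad)) < e / 2" using c(2) by linarith
      have part: "bad tagged_partial_division_of {a..b}"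
        by (rule tagged_partial_division_subset[of p])
          (use p in \<open>auto simp: bad_def tagged_division_of_def\<close>)
      have div: "(snd ` bad) division_of \<Union>(snd ` bad)"
        by (rule partial_division_of_tagged_division[OF part])
      have sub: "\<Union>(snd ` bad) \<subseteq> {a..b}" "\<Union>(snd ` bad) \<subseteq> U"
      proof -
        have "K \<subseteq> {a..b} \<and> K \<subseteq> U" if "(x, K) \<in> bad" for x K
        proof -
          have xK': "(x, K) \<in> p" "x \<in> S" using that by (simp_all add: bad_def)
          obtain u v where "K = {u..v}" "a \<le> u" "v \<le> b" "K \<subseteq> \<gamma> x" using xK[OF xK'(1)] by blast
          then show ?thesis using xK'(2) by (simp add: \<gamma>_def)
        qed
        then have *: "\<forall>K\<in>snd ` bad. K \<subseteq> {a..b} \<and> K \<subseteq> U" by (metis imageE prod.collapse)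
        show "\<Union>(snd ` bad) \<subseteq> {a..b}"
          by (rule Union_least) (rule conjunct1[OF bspec[OF *]])
        show "\<Union>(snd ` bad) \<subseteq> U"
          by (rule Union_least) (rule conjunct2[OF bspec[OF *]])
      qed
      \<comment> \<open>The summation lemma for tagged divisions requires the value 0 on empty intervals, too.\<close>
      define N where "N K = (if K = {} then 0 else norm (f (Sup K) - f (Inf K)))" for K
      have "norm (sum F bad) \<le> (\<Sum>(x,K)\<in>bad. N K)"
      proof (rule sum_norm_le)
        fix z assume "z \<in> bad"
        moreover obtain x K where z: "z = (x, K)" by (cases z)
        ultimately have bad: "(x, K) \<in> bad" by simp
        have "x \<in> S" using bad by (simp add: bad_def)
        moreover have "K \<noteq> {}"
          using tagged_partial_division_ofD(2)[OF part bad] by (rule ex_in_conv[THEN iffD1, OF exI])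
        ultimately show "norm (F z) \<le> (case z of (x, K) \<Rightarrow> N K)"
          by (simp add: z F_def N_def norm_minus_commute)
      qed
      also have "\<dots> = (\<Sum>K\<in>snd ` bad. N K)"
      proof (rule sum.over_tagged_division_lemma[OF tagged_partial_division_of_Union_self[OF part]])
        fix u v :: real assume "box u v = {}"
        then have "v < u \<or> u = v" by (auto simp: box_real)
        then show "N (cbox u v) = 0" by (auto simp: N_def)
      qed
      also have "\<dots> = (\<Sum>K\<in>snd ` bad. norm (f (Sup K) - f (Inf K)))"
        by (rule sum.cong[OF refl]) (use division_ofD(3)[OF div] in \<open>simp add: N_def\<close>)
      also have "\<dots> < e / 2"
      proof (rule \<delta>(2)[rule_format, OF div sub(1)])
        have "(\<Sum>K\<in>snd ` bad. Sup K - Inf K) = (\<Sum>K\<in>snd ` bad. measure lebesgue K)"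
        proof (rule sum.cong[OF refl])
          fix K assume "K \<in> snd ` bad"
          then obtain u v where "K = {u..v}" "u \<le> v" "Inf K = u" "Sup K = v"
            using division_real_interval[OF div] by metis
          then show "Sup K - Inf K = measure lebesgue K" by simp
        qed
        also have "\<dots> = measure lebesgue (\<Union>(snd ` bad))" by (rule content_division[OF div])
        also have "\<dots> \<le> measure lebesgue U"
          by (rule measure_mono_fmeasurable[OF sub(2) _ U'(1)])
            (use lmeasurable_division[OF div] in auto)
        finally show "(\<Sum>K\<in>snd ` bad. Sup K - Inf K) < \<delta>" using U'(2) by linarith
      qed
      finally have "norm (sum F bad) < e / 2" .
      with good norm_triangle_ineq[of "sum F bad" "sum F (p - bad)"]
      show ?thesis unfolding split by linarith
    qed
    show "\<exists>\<gamma>. gauge \<gamma> \<and> (\<forall>\<D>. \<D> tagged_division_of {a..b} \<and> \<gamma> fine \<D> \<longrightarrow>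
        norm ((\<Sum>(x, k)\<in>\<D>. Henstock_Kurzweil_Integration.content k *\<^sub>R (if x \<in> S then 0 else g x)) - (f b - f a)) < e)"
      by (rule exI[of _ \<gamma>], rule conjI[OF gauge], rule allI, rule impI, erule conjE, rule main)
  qed
qed simp

section \<open>Horizontal curves and their lengths\<close>

lemma AE_lebesgue_on_interval_iff:
  fixes a b :: real
  shows "(AE t in lebesgue_on {a..b}. P t) \<longleftrightarrow> (\<exists>S. negligible S \<and> (\<forall>t\<in>{a..b} - S. P t))"
proof -
  have "(AE t in lebesgue_on {a..b}. P t) \<longleftrightarrow> (AE t in lebesgue. t \<in> {a..b} \<longrightarrow> P t)"
    by (rule AE_restrict_space_iff) simp
  also have "\<dots> \<longleftrightarrow> (\<exists>S\<in>null_sets lebesgue. {t. \<not> (t \<in> {a..b} \<longrightarrow> P t)} \<subseteq> S)"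
    by (simp add: eventually_ae_filter)
  also have "\<dots> \<longleftrightarrow> (\<exists>S. negligible S \<and> (\<forall>t\<in>{a..b} - S. P t))"
    unfolding negligible_iff_null_sets by blast
  finally show ?thesis .
qed

definition horizontal_velocity :: "(2 \<Rightarrow> real^5) \<Rightarrow> real^2 \<Rightarrow> real^5 \<Rightarrow> real^5" where
  "horizontal_velocity X v p = (\<Sum>j\<in>UNIV. v $ j *\<^sub>R left_invariant_field (X j) p)"

lemma horizontal_velocity_scaleR:
  "horizontal_velocity X (c *\<^sub>R v) p = c *\<^sub>R horizontal_velocity X v p"
  by (simp add: horizontal_velocity_def scaleR_sum_right)

lemma horizontal_curve_iff:
  "horizontal_curve X a b \<gamma> u \<longleftrightarrow>
     a < b \<and> absolutely_continuous_curve a b \<gamma> \<and> u absolutely_integrable_on {a..b} \<and>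
     (\<exists>S. negligible S \<and> (\<forall>t\<in>{a..b} - S.
        (\<gamma> has_vector_derivative horizontal_velocity X (u t) (\<gamma> t)) (at t within {a..b})))"
proof -
  have "(\<forall>j. (\<lambda>t. u t $ j) absolutely_integrable_on {a..b}) \<longleftrightarrow> u absolutely_integrable_on {a..b}"
    unfolding absolutely_integrable_componentwise_iff[where f = u]
    by (auto simp: Basis_vec_def cart_eq_inner_axis)
  then show ?thesis
    unfolding horizontal_curve_def AE_lebesgue_on_interval_iff horizontal_velocity_def by simp
qed

text \<open>Lengths stated by \<open>has_integral\<close> instead of \<open>integral\<close> can be reversed and added without separate
  integrability conditions.\<close>
definition horizontally_joined :: "(2 \<Rightarrow> real^5) \<Rightarrow> real^5 \<Rightarrow> real^5 \<Rightarrow> real \<Rightarrow> bool" where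
  "horizontally_joined X x y l \<longleftrightarrow>
     (\<exists>a b \<gamma> u. horizontal_curve X a b \<gamma> u \<and> \<gamma> a = x \<and> \<gamma> b = y \<and> ((\<lambda>t. norm (u t)) has_integral l) {a..b})"

lemma horizontal_curve_length_integrable:
  assumes "horizontal_curve X a b \<gamma> u"
  shows "(\<lambda>t. norm (u t)) integrable_on {a..b}"
  using assms by (auto simp: horizontal_curve_iff absolutely_integrable_on_def)

lemma cc_dist_eq: "cc_dist X x y = Inf {l. horizontally_joined X x y l}"
proof -
  have "{integral {a..b} (\<lambda>t. norm (u t)) |a b \<gamma> u.
            horizontal_curve X a b \<gamma> u \<and> \<gamma> a = x \<and> \<gamma> b = y} = {l. horizontally_joined X x y l}"
  proof (intro set_eqI iffI)
    fix l assume "l \<in> {integral {a..b} (\<lambda>t. norm (u t)) |a b \<gamma> u.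
            horizontal_curve X a b \<gamma> u \<and> \<gamma> a = x \<and> \<gamma> b = y}"
    then obtain a b \<gamma> u where *: "horizontal_curve X a b \<gamma> u" "\<gamma> a = x" "\<gamma> b = y"
      and l: "l = integral {a..b} (\<lambda>t. norm (u t))" by blast
    have "((\<lambda>t. norm (u t)) has_integral l) {a..b}"
      unfolding l by (rule integrable_integral[OF horizontal_curve_length_integrable[OF *(1)]])
    with * show "l \<in> {l. horizontally_joined X x y l}"
      unfolding horizontally_joined_def by blast
  next
    fix l assume "l \<in> {l. horizontally_joined X x y l}"
    then obtain a b \<gamma> u where *: "horizontal_curve X a b \<gamma> u" "\<gamma> a = x" "\<gamma> b = y"
      and "((\<lambda>t. norm (u t)) has_integral l) {a..b}"
      unfolding horizontally_joined_def by blast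
    then have "l = integral {a..b} (\<lambda>t. norm (u t))" by (simp add: integral_unique)
    with * show "l \<in> {integral {a..b} (\<lambda>t. norm (u t)) |a b \<gamma> u.
            horizontal_curve X a b \<gamma> u \<and> \<gamma> a = x \<and> \<gamma> b = y}" by blast
  qed
  then show ?thesis by (simp add: cc_dist_def)
qed

lemma horizontally_joined_nonneg: "horizontally_joined X x y l \<Longrightarrow> 0 \<le> l"
  unfolding horizontally_joined_def by (auto intro: has_integral_nonneg)

lemma cc_dist_le: "horizontally_joined X x y l \<Longrightarrow> cc_dist X x y \<le> l"
  unfolding cc_dist_eq
  by (rule cInf_lower) (auto intro: bdd_belowI horizontally_joined_nonneg)

text \<open>Translation (\<open>m = 1\<close>) and reversal (\<open>m = - 1\<close>) of the parameter at once.\<close>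
lemma horizontal_curve_affine_reparam:
  assumes \<gamma>: "horizontal_curve X a b \<gamma> u"
    and m: "m = 1 \<and> c = a - k \<and> d = b - k \<or> m = - 1 \<and> c = k - b \<and> d = k - a"
  shows "horizontal_curve X c d (\<lambda>t. \<gamma> (m * t + k)) (\<lambda>t. m *\<^sub>R u (m * t + k))"
    and "((\<lambda>t. norm (u t)) has_integral l) {a..b} \<Longrightarrow>
      ((\<lambda>t. norm (m *\<^sub>R u (m * t + k))) has_integral l) {c..d}"
proof -
  have ab: "a < b" and AC: "absolutely_continuous_curve a b \<gamma>" and u: "u absolutely_integrable_on {a..b}"
    using \<gamma> by (auto simp: horizontal_curve_iff)
  obtain S where S: "negligible S" and deriv: "\<And>t. t \<in> {a..b} - S \<Longrightarrow>
      (\<gamma> has_vector_derivative horizontal_velocity X (u t) (\<gamma> t)) (at t within {a..b})"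
    using \<gamma> by (auto simp: horizontal_curve_iff)
  have m1: "\<bar>m\<bar> = 1" "m \<noteq> 0" "1 / m = m" "m * m = 1" using m by auto
  have img: "(\<lambda>x. (1 / m) *\<^sub>R x + - ((1 / m) *\<^sub>R k)) ` cbox a b = {c..d}"
    using m ab by (auto simp: image_affinity_cbox)
  have img': "(\<lambda>t. m * t + k) ` {c..d} = {a..b}"
    using m ab image_affinity_cbox[of m k c d] by auto
  have aff: "((\<lambda>t. f (m * t + k)) has_integral i) {c..d}" if "(f has_integral i) {a..b}"
    for f :: "real \<Rightarrow> 'b::real_normed_vector" and i
  proof -
    have "(f has_integral i) (cbox a b)" using that by simp
    from has_integral_affinity[OF this m1(2), of k] show ?thesis
      unfolding img by (simp add: m1(1))
  qed
  show "((\<lambda>t. norm (m *\<^sub>R u (m * t + k))) has_integral l) {c..d}"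
    if "((\<lambda>t. norm (u t)) has_integral l) {a..b}"
    using aff[OF that] by (simp add: m1(1))
  show "horizontal_curve X c d (\<lambda>t. \<gamma> (m * t + k)) (\<lambda>t. m *\<^sub>R u (m * t + k))"
    unfolding horizontal_curve_iff
  proof (intro conjI)
    show "c < d" using m ab by auto
    show "absolutely_continuous_curve c d (\<lambda>t. \<gamma> (m * t + k))"
    proof (rule absolutely_continuous_curve_reparam[OF AC])
      show "m * t + k \<in> {a..b}" if "t \<in> {c..d}" for t
        using that img' by blast
      show "\<bar>(m * t + k) - (m * s + k)\<bar> \<le> \<bar>t - s\<bar>" for s t
        using m by auto
      show "mono_on {c..d} (\<lambda>t. m * t + k) \<or> antimono_on {c..d} (\<lambda>t. m * t + k)"
        using m by (auto simp: monotone_on_def)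
    qed
    have "(\<lambda>t. u (m * t + k)) absolutely_integrable_on {c..d}"
      using u aff[of u] aff[of "\<lambda>t. norm (u t)"]
      unfolding absolutely_integrable_on_def integrable_on_def by blast
    then show "(\<lambda>t. m *\<^sub>R u (m * t + k)) absolutely_integrable_on {c..d}"
      by (rule absolutely_integrable_scaleR_left)
    show "\<exists>S. negligible S \<and> (\<forall>t\<in>{c..d} - S. ((\<lambda>t. \<gamma> (m * t + k)) has_vector_derivative
        horizontal_velocity X (m *\<^sub>R u (m * t + k)) (\<gamma> (m * t + k))) (at t within {c..d}))"
    proof (intro exI conjI ballI)
      have "(\<lambda>s. m * (s - k)) differentiable_on S" by (intro derivative_intros)
      with S show "negligible ((\<lambda>s. m * (s - k)) ` S)"
        by (intro negligible_differentiable_image_negligible) auto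
      fix t assume t: "t \<in> {c..d} - (\<lambda>s. m * (s - k)) ` S"
      have "m * t + k \<notin> S"
      proof
        assume "m * t + k \<in> S"
        moreover have "t = m * ((m * t + k) - k)"
          using m1(4) by (simp add: mult.assoc[symmetric])
        ultimately show False using t by blast
      qed
      moreover have "m * t + k \<in> {a..b}" using t img' by blast
      ultimately have *: "(\<gamma> has_vector_derivative horizontal_velocity X (u (m * t + k)) (\<gamma> (m * t + k)))
          (at (m * t + k) within (\<lambda>t. m * t + k) ` {c..d})"
        unfolding img' by (intro deriv) simp
      have "((\<lambda>t. m * t + k) has_vector_derivative m) (at t within {c..d})"
        by (auto intro!: derivative_eq_intros)
      from vector_diff_chain_within[OF this *]
      show "((\<lambda>t. \<gamma> (m * t + k)) has_vector_derivative
        horizontal_velocity X (m *\<^sub>R u (m * t + k)) (\<gamma> (m * t + k))) (at t within {c..d})"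
        by (simp add: o_def horizontal_velocity_scaleR)
    qed
  qed
qed

lemma horizontally_joined_sym:
  assumes "horizontally_joined X x y l"
  shows "horizontally_joined X y x l"
proof -
  obtain a b \<gamma> u where *: "horizontal_curve X a b \<gamma> u" "\<gamma> a = x" "\<gamma> b = y"
    "((\<lambda>t. norm (u t)) has_integral l) {a..b}"
    using assms by (auto simp: horizontally_joined_def)
  have m: "(- 1::real) = 1 \<and> - b = a - 0 \<and> - a = b - 0 \<or> - 1 = (- 1::real) \<and> - b = 0 - b \<and> - a = 0 - a"
    by simp
  show ?thesis
    unfolding horizontally_joined_def
    by (intro exI[of _ "- b"] exI[of _ "- a"] exI[of _ "\<lambda>t. \<gamma> (- 1 * t + 0)"]
        exI[of _ "\<lambda>t. - 1 *\<^sub>R u (- 1 * t + 0)"] conjI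
        horizontal_curve_affine_reparam[OF *(1) m] *(4)) (simp_all add: *)
qed

lemma cc_dist_sym: "cc_dist X x y = cc_dist X y x"
proof -
  have "horizontally_joined X x y = horizontally_joined X y x"
    by (auto simp: fun_eq_iff intro: horizontally_joined_sym)
  then show ?thesis by (simp add: cc_dist_eq)
qed

lemma horizontally_joined_trans:
  assumes "horizontally_joined X x y l" "horizontally_joined X y z l'"
  shows "horizontally_joined X x z (l + l')"
proof -
  obtain a b \<gamma>1 u1 where 1: "horizontal_curve X a b \<gamma>1 u1" "\<gamma>1 a = x" "\<gamma>1 b = y"
    "((\<lambda>t. norm (u1 t)) has_integral l) {a..b}"
    using assms(1) by (auto simp: horizontally_joined_def)
  obtain b' c' \<gamma>2' u2' where 2: "horizontal_curve X b' c' \<gamma>2' u2'" "\<gamma>2' b' = y" "\<gamma>2' c' = z"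
    "((\<lambda>t. norm (u2' t)) has_integral l') {b'..c'}"
    using assms(2) by (auto simp: horizontally_joined_def)
  define c where "c = c' - (b' - b)"
  have m: "(1::real) = 1 \<and> b = b' - (b' - b) \<and> c = c' - (b' - b) \<or>
      1 = - (1::real) \<and> b = (b' - b) - c' \<and> c = (b' - b) - b'"
    by (simp add: c_def)
  define \<gamma>2 where "\<gamma>2 t = \<gamma>2' (1 * t + (b' - b))" for t
  define u2 where "u2 t = 1 *\<^sub>R u2' (1 * t + (b' - b))" for t
  have 3: "horizontal_curve X b c \<gamma>2 u2" "\<gamma>2 b = y" "\<gamma>2 c = z"
    "((\<lambda>t. norm (u2 t)) has_integral l') {b..c}"
    using horizontal_curve_affine_reparam[OF 2(1) m] 2
    by (simp_all add: \<gamma>2_def[abs_def] u2_def[abs_def] c_def)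
  have ab: "a < b" and bc: "b < c" using 1(1) 3(1) by (auto simp: horizontal_curve_iff)
  obtain S1 where S1: "negligible S1" "\<And>t. t \<in> {a..b} - S1 \<Longrightarrow>
      (\<gamma>1 has_vector_derivative horizontal_velocity X (u1 t) (\<gamma>1 t)) (at t within {a..b})"
    using 1(1) by (auto simp: horizontal_curve_iff)
  obtain S2 where S2: "negligible S2" "\<And>t. t \<in> {b..c} - S2 \<Longrightarrow>
      (\<gamma>2 has_vector_derivative horizontal_velocity X (u2 t) (\<gamma>2 t)) (at t within {b..c})"
    using 3(1) by (auto simp: horizontal_curve_iff)
  \<comment> \<open>Both clamped curves are constant beyond \<open>b\<close>, where they have the value \<open>y\<close>.\<close>
  define \<gamma> where "\<gamma> t = \<gamma>1 (min t b) + (\<gamma>2 (max t b) + - y)" for t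
  define u where "u t = (if t \<le> b then u1 t else u2 t)" for t
  have \<gamma>1: "\<gamma> t = \<gamma>1 t" if "t \<le> b" for t using that by (simp add: \<gamma>_def 3(2))
  have \<gamma>2: "\<gamma> t = \<gamma>2 t" if "b \<le> t" for t using that by (simp add: \<gamma>_def 1(3))
  have glue: "((\<lambda>t. if t \<le> b then f t else g t) has_integral (i + j)) {a..c}"
    if f: "(f has_integral i) {a..b}" and g: "(g has_integral j) {b..c}"
    for f g :: "real \<Rightarrow> 'b::banach" and i j
  proof (rule has_integral_combine[of a b c])
    show "((\<lambda>t. if t \<le> b then f t else g t) has_integral i) {a..b}"
      by (rule has_integral_eq[OF _ f]) simp
    show "((\<lambda>t. if t \<le> b then f t else g t) has_integral j) {b..c}"
      by (rule has_integral_spike[OF negligible_sing[of b] _ g]) auto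
  qed (use ab bc in auto)
  have len: "((\<lambda>t. norm (u t)) has_integral (l + l')) {a..c}"
    using glue[OF 1(4) 3(4)] by (simp add: u_def if_distrib)
  have "horizontal_curve X a c \<gamma> u"
    unfolding horizontal_curve_iff
  proof (intro conjI)
    show "a < c" using ab bc by simp
    have "absolutely_continuous_curve a c (\<lambda>t. \<gamma>1 (min t b))"
      by (rule absolutely_continuous_curve_reparam[of a b])
        (use 1(1) ab bc in \<open>auto simp: horizontal_curve_iff monotone_on_def\<close>)
    moreover have "absolutely_continuous_curve a c (\<lambda>t. \<gamma>2 (max t b))"
      by (rule absolutely_continuous_curve_reparam[of b c])
        (use 3(1) ab bc in \<open>auto simp: horizontal_curve_iff monotone_on_def\<close>)
    ultimately show "absolutely_continuous_curve a c \<gamma>"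
      unfolding \<gamma>_def[abs_def]
      by (intro absolutely_continuous_curve_add absolutely_continuous_curve_const)
    have "u1 integrable_on {a..b}" "u2 integrable_on {b..c}"
      using 1(1) 3(1) by (auto simp: horizontal_curve_iff absolutely_integrable_on_def)
    then have "u integrable_on {a..c}"
      using glue unfolding u_def[abs_def] integrable_on_def by blast
    with len show "u absolutely_integrable_on {a..c}"
      by (auto simp: absolutely_integrable_on_def integrable_on_def)
    show "\<exists>S. negligible S \<and> (\<forall>t\<in>{a..c} - S.
        (\<gamma> has_vector_derivative horizontal_velocity X (u t) (\<gamma> t)) (at t within {a..c}))"
    proof (intro exI conjI ballI)
      show "negligible (S1 \<union> S2 \<union> {a, b, c})"
        using S1(1) S2(1) by (intro negligible_Un) auto
      fix t assume t: "t \<in> {a..c} - (S1 \<union> S2 \<union> {a, b, c})"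
      have "(\<gamma> has_vector_derivative horizontal_velocity X (u t) (\<gamma> t)) (at t)"
      proof (cases "t < b")
        case True
        then have "(\<gamma>1 has_vector_derivative horizontal_velocity X (u t) (\<gamma> t)) (at t)"
          using S1(2)[of t] t at_within_Icc_at[of a t b] by (simp add: u_def \<gamma>1)
        then show ?thesis
          by (rule has_vector_derivative_transform_within_open[of _ _ _ "{..<b}"])
            (use True \<gamma>1 in auto)
      next
        case False
        then have "(\<gamma>2 has_vector_derivative horizontal_velocity X (u t) (\<gamma> t)) (at t)"
          using S2(2)[of t] t at_within_Icc_at[of b t c] by (simp add: u_def \<gamma>2)
        then show ?thesis
          by (rule has_vector_derivative_transform_within_open[of _ _ _ "{b<..}"])
            (use False t \<gamma>2 in auto)
      qed
      then show "(\<gamma> has_vector_derivative horizontal_velocity X (u t) (\<gamma> t)) (at t within {a..c})"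
        by (rule has_vector_derivative_at_within)
    qed
  qed
  then show ?thesis
    unfolding horizontally_joined_def
    by (intro exI[of _ a] exI[of _ c] exI[of _ \<gamma>] exI[of _ u] conjI len)
      (use ab bc 1(2) 3(3) in \<open>simp_all add: \<gamma>1 \<gamma>2\<close>)
qed

lemma horizontal_velocity_eq:
  "horizontal_velocity X c p = left_invariant_field (\<Sum>j\<in>UNIV. c $ j *\<^sub>R X j) p"
  unfolding horizontal_velocity_def left_invariant_field_eq
  by (intro f23_eqI; simp only: vector_add_component vector_scaleR_component f23_bracket_nth
      sum_component UNIV_2 sum.insert) (simp_all add: algebra_simps)

lemma horizontally_joined_segment:
  "horizontally_joined X x (x \<odot> (\<Sum>j\<in>UNIV. c $ j *\<^sub>R X j)) (norm c)"
proof -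
  define Y where "Y = (\<Sum>j\<in>UNIV. c $ j *\<^sub>R X j)"
  define \<gamma> where "\<gamma> t = x \<odot> (t *\<^sub>R Y)" for t
  have vel: "left_invariant_field Y p = horizontal_velocity X c p" for p
    by (simp add: Y_def horizontal_velocity_eq)
  have deriv: "(\<gamma> has_vector_derivative horizontal_velocity X c (\<gamma> t)) (at t)" for t
  proof -
    have "\<gamma> = (\<lambda>s. \<gamma> t \<odot> f23_exp ((s - t) *\<^sub>R Y))"
    proof
      fix s show "\<gamma> s = \<gamma> t \<odot> f23_exp ((s - t) *\<^sub>R Y)"
        using f23_exp_one_parameter[of t Y "s - t"] by (simp add: \<gamma>_def f23_group f23_exp_def)
    qed
    moreover have "((\<lambda>h. \<gamma> t \<odot> f23_exp (h *\<^sub>R Y)) \<circ> (\<lambda>s. s - t) has_vector_derivative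
        1 *\<^sub>R horizontal_velocity X c (\<gamma> t)) (at t)"
    proof (rule vector_diff_chain_at)
      show "((\<lambda>s. s - t) has_vector_derivative 1) (at t)" by (auto intro!: derivative_eq_intros)
      show "((\<lambda>h. \<gamma> t \<odot> f23_exp (h *\<^sub>R Y)) has_vector_derivative horizontal_velocity X c (\<gamma> t)) (at (t - t))"
        using has_vector_derivative_left_invariant_field[where p = "\<gamma> t" and Y = Y] by (simp add: vel)
    qed
    ultimately show ?thesis by (simp add: o_def)
  qed
  define A where "A = left_invariant_field Y x"
  define B where "B = (1/12) *\<^sub>R f23_bracket Y (f23_bracket Y x)"
  have \<gamma>_quadratic: "\<gamma> t = x + t *\<^sub>R A + t\<^sup>2 *\<^sub>R B" for t
    unfolding \<gamma>_def A_def B_def left_invariant_field_eq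
    by (intro f23_eqI; simp only: f23_mult_nth vector_add_component vector_scaleR_component
        f23_bracket_nth real_scaleR_def; simp add: field_simps power2_eq_square)
  have "horizontal_curve X 0 1 \<gamma> (\<lambda>_. c)"
    unfolding horizontal_curve_iff
  proof (intro conjI exI ballI)
    show "absolutely_continuous_curve 0 1 \<gamma>"
    proof (rule absolutely_continuous_curve_Lipschitz)
      fix s t :: real assume st: "0 \<le> s" "s \<le> t" "t \<le> 1"
      have "\<gamma> t - \<gamma> s = (t - s) *\<^sub>R (A + (t + s) *\<^sub>R B)"
        by (simp add: \<gamma>_quadratic algebra_simps power2_eq_square)
      then have "norm (\<gamma> t - \<gamma> s) = (t - s) * norm (A + (t + s) *\<^sub>R B)"
        using st by simp
      also have "\<dots> \<le> (t - s) * (norm A + 2 * norm B)"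
      proof (rule mult_left_mono)
        have "norm (A + (t + s) *\<^sub>R B) \<le> norm A + norm ((t + s) *\<^sub>R B)"
          by (rule norm_triangle_ineq)
        also have "norm ((t + s) *\<^sub>R B) \<le> 2 * norm B"
          using st by (simp add: mult_right_mono)
        finally show "norm (A + (t + s) *\<^sub>R B) \<le> norm A + 2 * norm B" by simp
      qed (use st in simp)
      finally show "norm (\<gamma> t - \<gamma> s) \<le> (norm A + 2 * norm B) * (t - s)"
        by (simp add: mult.commute)
    qed
    show "(\<lambda>_. c) absolutely_integrable_on {0..1::real}"
      by (intro absolutely_integrable_continuous_real continuous_on_const)
  qed (use deriv in \<open>auto intro: has_vector_derivative_at_within\<close>)
  moreover have "((\<lambda>t. norm c) has_integral norm c) {0..1::real}"
    using has_integral_const_real[of "norm c" 0 1] by simp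
  ultimately show ?thesis
    unfolding horizontally_joined_def Y_def[symmetric]
    by (intro exI[of _ 0] exI[of _ 1] exI[of _ \<gamma>] exI[of _ "\<lambda>_. c"]) (simp add: \<gamma>_def f23_group)
qed

section \<open>The cost of turning back\<close>

text \<open>Here \<open>w\<close> is the speed in the preferred direction, \<open>n\<close> the total speed and \<open>q\<close> the transverse
  coordinate. Only backward motion contributes negatively to the integral of \<open>q\<^sup>2 w\<close>. The amount of it is at
  most half the excess length \<open>l - W\<close>; the bound is cubic because an excursion to height \<open>\<bar>q\<bar> = h\<close> has to come
  back, and contributes positively on its way unless \<open>h\<close> itself is of the order of \<open>l - W\<close>.\<close>
lemma turning_back_estimate:
  fixes w n q :: "real \<Rightarrow> real"
  assumes "a \<le> b" and w: "(w has_integral W) {a..b}" and n: "(n has_integral l) {a..b}"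
    and wn: "\<And>t. t \<in> {a..b} \<Longrightarrow> \<bar>w t\<bar> \<le> n t"
    and q: "continuous_on {a..b} q" "q b = 0"
    and "0 < K" and var: "\<And>s t. \<lbrakk>a \<le> s; s \<le> t; t \<le> b\<rbrakk> \<Longrightarrow> \<bar>q t - q s\<bar> \<le> K * integral {s..t} n"
    and J: "((\<lambda>t. (q t)\<^sup>2 * w t) has_integral J) {a..b}"
  shows "- J \<le> 27 * K\<^sup>2 * (l - W) ^ 3"
proof -
  define \<delta> where "\<delta> = l - W"
  have "0 \<le> \<delta>"
    using has_integral_le[OF w n] wn unfolding \<delta>_def by force
  obtain t0 where t0: "t0 \<in> {a..b}" "\<And>t. t \<in> {a..b} \<Longrightarrow> \<bar>q t\<bar> \<le> \<bar>q t0\<bar>"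
    using continuous_attains_sup[of "{a..b}" "\<lambda>t. \<bar>q t\<bar>"] q(1) \<open>a \<le> b\<close>
    by (force intro: continuous_on_rabs)
  define h where "h = \<bar>q t0\<bar>"
  have "0 \<le> h" by (simp add: h_def)
  have "compact ({t0..b} \<inter> (\<lambda>t. \<bar>q t\<bar>) -` {..h / 2})"
  proof -
    have "continuous_on {t0..b} (\<lambda>t. \<bar>q t\<bar>)"
      using q(1) t0(1) by (intro continuous_on_rabs) (auto elim: continuous_on_subset)
    then have "closed ({t0..b} \<inter> (\<lambda>t. \<bar>q t\<bar>) -` {..h / 2})"
      by (intro continuous_closed_preimage) auto
    then show ?thesis by (metis compact_Icc compact_Int_closed inf.left_idem)
  qed
  moreover have "b \<in> {t0..b} \<inter> (\<lambda>t. \<bar>q t\<bar>) -` {..h / 2}"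
    using t0(1) q(2) \<open>0 \<le> h\<close> by simp
  \<comment> \<open>The first time after \<open>t0\<close> at which \<open>\<bar>q\<bar>\<close> has dropped to half its maximum.\<close>
  ultimately obtain s where s: "s \<in> {t0..b}" "\<bar>q s\<bar> \<le> h / 2"
    and s_first: "\<And>t. \<lbrakk>t \<in> {t0..b}; \<bar>q t\<bar> \<le> h / 2\<rbrakk> \<Longrightarrow> s \<le> t"
    using compact_attains_inf[of "{t0..b} \<inter> (\<lambda>t. \<bar>q t\<bar>) -` {..h / 2}"] by fastforce
  have sub: "{t0..s} \<subseteq> {a..b}" using t0(1) s(1) by auto
  \<comment> \<open>The second summand compensates the backward motion, so that \<open>g \<ge> 0\<close>: where \<open>w < 0\<close>, one has
    \<open>n - w \<ge> 2 \<bar>w\<bar>\<close>.\<close>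
  define g where "g t = (q t)\<^sup>2 * w t + h\<^sup>2 / 2 * (n t - w t)" for t
  have g_int: "(g has_integral (J + h\<^sup>2 / 2 * \<delta>)) {a..b}"
    unfolding g_def \<delta>_def by (intro has_integral_add J has_integral_mult_right has_integral_diff n w)
  have q2: "(q t)\<^sup>2 \<le> h\<^sup>2" if "t \<in> {a..b}" for t
    using t0(2)[OF that] by (simp add: h_def abs_le_square_iff)
  have g0: "0 \<le> g t" if t: "t \<in> {a..b}" for t
  proof (cases "0 \<le> w t")
    case True then show ?thesis using wn[OF t] by (simp add: g_def)
  next
    case False
    then have "h\<^sup>2 * w t \<le> (q t)\<^sup>2 * w t" using q2[OF t] by (intro mult_right_mono_neg) auto
    moreover have "h\<^sup>2 / 2 * (- 2 * w t) \<le> h\<^sup>2 / 2 * (n t - w t)"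
      using wn[OF t] False by (intro mult_left_mono) auto
    ultimately show ?thesis by (simp add: g_def)
  qed
  have g1: "h\<^sup>2 / 4 * w t \<le> g t" if t: "t \<in> {t0..s} - {s}" for t
  proof (cases "0 \<le> w t")
    case True
    have "h / 2 < \<bar>q t\<bar>" using s_first[of t] t s(1) by fastforce
    then have "(h / 2)\<^sup>2 \<le> \<bar>q t\<bar>\<^sup>2" using \<open>0 \<le> h\<close> by (intro power_mono) auto
    then have "(h / 2)\<^sup>2 \<le> (q t)\<^sup>2" by simp
    then have "h\<^sup>2 / 4 * w t \<le> (q t)\<^sup>2 * w t"
      using True by (intro mult_right_mono) (auto simp: power_divide)
    moreover have "0 \<le> h\<^sup>2 / 2 * (n t - w t)" using wn[of t] t sub True by auto
    ultimately show ?thesis unfolding g_def by linarith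
  next
    case False
    then have "h\<^sup>2 / 4 * w t \<le> 0" by (simp add: mult_nonneg_nonpos)
    also have "0 \<le> g t" using g0 t sub by blast
    finally show ?thesis .
  qed
  have int: "w integrable_on {t0..s}" "n integrable_on {t0..s}" "g integrable_on {t0..s}"
    using w n g_int sub by (meson has_integral_integrable integrable_on_subinterval)+
  have int4: "(\<lambda>t. h\<^sup>2 / 4 * w t) integrable_on {t0..s}"
    using integrable_cmul[OF int(1), of "h\<^sup>2 / 4"] by simp
  have "h\<^sup>2 / 4 * integral {t0..s} w = integral {t0..s} (\<lambda>t. h\<^sup>2 / 4 * w t)" by simp
  also have "\<dots> \<le> integral {t0..s} g"
  proof (rule integral_spike[of "{s}", THEN ord_eq_le_trans])
    show "integral {t0..s} (\<lambda>t. if t = s then g t else h\<^sup>2 / 4 * w t) \<le> integral {t0..s} g"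
    proof (rule integral_le)
      show "(\<lambda>t. if t = s then g t else h\<^sup>2 / 4 * w t) integrable_on {t0..s}"
        by (rule integrable_spike[OF int4 negligible_sing[of s]]) auto
    qed (use int g1 in auto)
  qed auto
  also have "\<dots> \<le> integral {a..b} g"
    by (rule integral_subset_le[OF sub int(3)]) (use g_int g0 in auto)
  also have "\<dots> = J + h\<^sup>2 / 2 * \<delta>" using g_int by (rule integral_unique)
  finally have 1: "h\<^sup>2 / 4 * integral {t0..s} w \<le> J + h\<^sup>2 / 2 * \<delta>" .
  have "integral {t0..s} n - integral {t0..s} w = integral {t0..s} (\<lambda>t. n t - w t)"
    using int by (simp add: integral_diff)
  also have "\<dots> \<le> integral {a..b} (\<lambda>t. n t - w t)"
    by (rule integral_subset_le[OF sub]) (use int w n wn in \<open>force intro: integrable_diff\<close>)+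
  also have "\<dots> = \<delta>" unfolding \<delta>_def by (intro integral_unique has_integral_diff n w)
  finally have 2: "integral {t0..s} n - \<delta> \<le> integral {t0..s} w" by simp
  have "h / 2 \<le> \<bar>q s - q t0\<bar>" using s(2) unfolding h_def by linarith
  also have "\<dots> \<le> K * integral {t0..s} n" by (rule var) (use t0(1) s(1) in auto)
  finally have 3: "h / (2 * K) \<le> integral {t0..s} n"
    using \<open>0 < K\<close> by (simp add: field_simps)
  have "h\<^sup>2 / 4 * (h / (2 * K) - \<delta>) \<le> h\<^sup>2 / 4 * integral {t0..s} w"
    using 2 3 by (intro mult_left_mono) auto
  with 1 have "- J \<le> h\<^sup>2 / 2 * \<delta> - h\<^sup>2 / 4 * (h / (2 * K) - \<delta>)" by linarith
  also have "\<dots> = h\<^sup>2 * (3 / 4 * \<delta> - h / (8 * K))" using \<open>0 < K\<close> by (simp add: field_simps)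
  finally have 4: "- J \<le> h\<^sup>2 * (3 / 4 * \<delta> - h / (8 * K))" .
  show ?thesis
  proof (cases "h \<le> 6 * K * \<delta>")
    case True
    have "h\<^sup>2 * (3 / 4 * \<delta> - h / (8 * K)) \<le> h\<^sup>2 * (3 / 4 * \<delta>)"
      using \<open>0 \<le> h\<close> \<open>0 < K\<close> by (intro mult_left_mono) auto
    also have "\<dots> \<le> (6 * K * \<delta>)\<^sup>2 * (3 / 4 * \<delta>)"
      using True \<open>0 \<le> h\<close> \<open>0 \<le> \<delta>\<close> by (intro mult_right_mono power_mono) auto
    also have "\<dots> = 27 * K\<^sup>2 * \<delta> ^ 3" by (simp add: power2_eq_square power3_eq_cube)
    finally show ?thesis using 4 by (simp add: \<delta>_def)
  next
    case False
    then have "3 / 4 * \<delta> - h / (8 * K) \<le> 0" using \<open>0 < K\<close> by (simp add: field_simps)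
    then have "h\<^sup>2 * (3 / 4 * \<delta> - h / (8 * K)) \<le> 0" by (simp add: mult_nonneg_nonpos)
    also have "0 \<le> 27 * K\<^sup>2 * (l - W) ^ 3" using \<open>0 \<le> \<delta>\<close> by (simp add: \<delta>_def)
    finally show ?thesis using 4 by simp
  qed
qed

section \<open>Horizontal coordinates and connectivity by horizontal curves\<close>

text \<open>Cramer's rule for the coefficients with respect to the basis \<open>X\<close>. It depends on the first two
  coordinates only, and so extends to the whole group the isomorphism of the horizontal layer with
  \<^typ>\<open>real^2\<close>.\<close>
definition horizontal_coords :: "(2 \<Rightarrow> real^5) \<Rightarrow> real^5 \<Rightarrow> real^2" where
  "horizontal_coords X x =
     (1 / (X 1 $ 1 * X 2 $ 2 - X 1 $ 2 * X 2 $ 1)) *\<^sub>R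
     vector [x$1 * X 2 $ 2 - x$2 * X 2 $ 1, X 1 $ 1 * x$2 - X 1 $ 2 * x$1]"

lemma horizontal_basis_in_V1:
  assumes "horizontal_basis X"
  shows "X j \<in> f23_V1" "X j $ 3 = 0" "X j $ 4 = 0" "X j $ 5 = 0"
proof -
  have "X j \<in> span (range X)" by (simp add: span_base)
  then show "X j \<in> f23_V1" using assms by (simp add: horizontal_basis_def)
  then show "X j $ 3 = 0" "X j $ 4 = 0" "X j $ 5 = 0" unfolding f23_V1_eq by auto
qed

text \<open>The two generators are combinations of \<open>X 1\<close> and \<open>X 2\<close>, so the determinant has an inverse.\<close>
lemma horizontal_basis_det_nonzero:
  assumes "horizontal_basis X"
  shows "X 1 $ 1 * X 2 $ 2 - X 1 $ 2 * X 2 $ 1 \<noteq> 0"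
proof -
  have "\<exists>a b. y = a *\<^sub>R X 1 + b *\<^sub>R X 2" if "y \<in> f23_V1" for y
  proof -
    have "y \<in> span {X 1, X 2}" using assms that by (simp add: horizontal_basis_def UNIV_2)
    then obtain a where "y - a *\<^sub>R X 1 \<in> span {X 2}" by (auto simp: span_breakdown_eq)
    then obtain b where "y - a *\<^sub>R X 1 = b *\<^sub>R X 2" by (auto simp: span_singleton)
    then show ?thesis by (metis add.commute diff_add_cancel)
  qed
  moreover have "axis 1 1 \<in> f23_V1" "axis 2 1 \<in> f23_V1" unfolding f23_V1_def by (auto intro: span_base)
  ultimately obtain a b c d where
    1: "axis 1 1 = a *\<^sub>R X 1 + b *\<^sub>R X 2" and 2: "axis 2 1 = c *\<^sub>R X 1 + d *\<^sub>R X 2"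
    by meson
  have "a * X 1 $ 1 + b * X 2 $ 1 = 1" "a * X 1 $ 2 + b * X 2 $ 2 = 0"
    using arg_cong[OF 1, of "\<lambda>v. v$1"] arg_cong[OF 1, of "\<lambda>v. v$2"]
    by (simp_all only: f23_axis_nth vector_add_component vector_scaleR_component) simp_all
  moreover have "c * X 1 $ 1 + d * X 2 $ 1 = 0" "c * X 1 $ 2 + d * X 2 $ 2 = 1"
    using arg_cong[OF 2, of "\<lambda>v. v$1"] arg_cong[OF 2, of "\<lambda>v. v$2"]
    by (simp_all only: f23_axis_nth vector_add_component vector_scaleR_component) simp_all
  moreover have "(a * d - b * c) * (X 1 $ 1 * X 2 $ 2 - X 1 $ 2 * X 2 $ 1) =
      (a * X 1 $ 1 + b * X 2 $ 1) * (c * X 1 $ 2 + d * X 2 $ 2) -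
      (a * X 1 $ 2 + b * X 2 $ 2) * (c * X 1 $ 1 + d * X 2 $ 1)"
    by (simp add: algebra_simps)
  ultimately show ?thesis by auto
qed

lemma linear_horizontal_coords: "linear (horizontal_coords X)"
proof (rule linearI)
  show "horizontal_coords X (x + y) = horizontal_coords X x + horizontal_coords X y" for x y
    unfolding horizontal_coords_def
    by (simp add: vec_eq_iff forall_2) (simp add: algebra_simps add_divide_distrib diff_divide_distrib)
  show "horizontal_coords X (r *\<^sub>R x) = r *\<^sub>R horizontal_coords X x" for r x
    unfolding horizontal_coords_def
    by (simp add: vec_eq_iff forall_2) (simp add: algebra_simps diff_divide_distrib)
qed

lemmas horizontal_coords_add = linear_add[OF linear_horizontal_coords]
lemmas horizontal_coords_scaleR = linear_scale[OF linear_horizontal_coords]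
lemmas horizontal_coords_minus = linear_neg[OF linear_horizontal_coords]

lemma horizontal_coords_cong:
  "x$1 = y$1 \<Longrightarrow> x$2 = y$2 \<Longrightarrow> horizontal_coords X x = horizontal_coords X y"
  by (simp add: horizontal_coords_def)

lemma horizontal_coords_basis:
  assumes "horizontal_basis X"
  shows "horizontal_coords X (X 1) = vector [1, 0]" "horizontal_coords X (X 2) = vector [0, 1]"
  using horizontal_basis_det_nonzero[OF assms] unfolding horizontal_coords_def
  by (simp_all add: vec_eq_iff forall_2 field_simps)

lemma horizontal_coords_combination:
  assumes "horizontal_basis X"
  shows "horizontal_coords X (\<Sum>j\<in>UNIV. c $ j *\<^sub>R X j) = c"
  by (simp add: UNIV_2 horizontal_coords_add horizontal_coords_scaleR horizontal_coords_basis[OF assms])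
    (simp add: vec_eq_iff forall_2)

lemma horizontal_coords_expansion:
  assumes X: "horizontal_basis X" and "Y \<in> f23_V1"
  shows "(\<Sum>j\<in>UNIV. horizontal_coords X Y $ j *\<^sub>R X j) = Y"
proof -
  define D where "D = X 1 $ 1 * X 2 $ 2 - X 1 $ 2 * X 2 $ 1"
  have D: "D \<noteq> 0" using horizontal_basis_det_nonzero[OF X] by (simp add: D_def)
  have c: "horizontal_coords X Y $ 1 = (Y$1 * X 2 $ 2 - Y$2 * X 2 $ 1) / D"
    "horizontal_coords X Y $ 2 = (X 1 $ 1 * Y$2 - X 1 $ 2 * Y$1) / D"
    by (simp_all add: horizontal_coords_def D_def)
  have "D * ((Y$1 * X 2 $ 2 - Y$2 * X 2 $ 1) / D * X 1 $ i + (X 1 $ 1 * Y$2 - X 1 $ 2 * Y$1) / D * X 2 $ i)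
      = D * Y $ i" if "i = 1 \<or> i = 2" for i
  proof -
    have "D * ((Y$1 * X 2 $ 2 - Y$2 * X 2 $ 1) / D * X 1 $ i + (X 1 $ 1 * Y$2 - X 1 $ 2 * Y$1) / D * X 2 $ i)
      = (Y$1 * X 2 $ 2 - Y$2 * X 2 $ 1) * X 1 $ i + (X 1 $ 1 * Y$2 - X 1 $ 2 * Y$1) * X 2 $ i"
      using D by (simp add: distrib_left)
    also have "\<dots> = D * Y $ i" using that by (auto simp: D_def algebra_simps)
    finally show ?thesis .
  qed
  then have e: "(Y$1 * X 2 $ 2 - Y$2 * X 2 $ 1) / D * X 1 $ i + (X 1 $ 1 * Y$2 - X 1 $ 2 * Y$1) / D * X 2 $ i
      = Y $ i" if "i = 1 \<or> i = 2" for i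
    using that D mult_left_cancel by blast
  have Y: "Y$3 = 0" "Y$4 = 0" "Y$5 = 0" using \<open>Y \<in> f23_V1\<close> unfolding f23_V1_eq by auto
  show ?thesis
    unfolding UNIV_2
    by (rule f23_eqI)
      (use e[of 1] e[of 2] in \<open>simp_all add: c Y horizontal_basis_in_V1(2-)[OF X] del: times_divide_eq_left\<close>)
qed

lemma horizontal_norm_eq:
  assumes X: "horizontal_basis X" and Y: "Y \<in> f23_V1"
  shows "horizontal_norm X Y = norm (horizontal_coords X Y)"
proof -
  have ind: "independent (range X)" and "inj X" using X by (auto simp: horizontal_basis_def)
  have span: "X j \<in> span (range X)" for j by (simp add: span_base)
  define c where "c = horizontal_coords X Y"
  have Yeq: "Y = c$1 *\<^sub>R X 1 + c$2 *\<^sub>R X 2"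
    using horizontal_coords_expansion[OF X Y] by (simp add: UNIV_2 c_def)
  have ne: "X 1 \<noteq> X 2" using \<open>inj X\<close> by (auto dest: injD)
  have "representation (range X) Y v = c$1 * representation (range X) (X 1) v + c$2 * representation (range X) (X 2) v" for v
    unfolding Yeq by (simp add: representation_add representation_scale ind span span_scale)
  then have "representation (range X) Y (X 1) = c$1" "representation (range X) Y (X 2) = c$2"
    using ne by (simp_all add: representation_basis ind)
  then show ?thesis
    by (simp add: horizontal_norm_def UNIV_2 norm_vec_def L2_set_def c_def)
qed

lemma horizontally_joined_horizontal:
  assumes "horizontal_basis X" "Y \<in> f23_V1"
  shows "horizontally_joined X x (x \<odot> Y) (norm (horizontal_coords X Y))"
  using horizontally_joined_segment[of X x "horizontal_coords X Y"]
  by (simp add: horizontal_coords_expansion[OF assms])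

definition f23_commutator :: "real^5 \<Rightarrow> real^5 \<Rightarrow> real^5" where
  "f23_commutator g h = g \<odot> h \<odot> f23_inv g \<odot> f23_inv h"

lemma horizontally_joined_commutator:
  assumes g: "\<And>x. horizontally_joined X x (x \<odot> g) l"
    and h: "\<And>x. horizontally_joined X x (x \<odot> h) l'"
  shows "horizontally_joined X x (x \<odot> f23_commutator g h) (l + l' + l + l')"
proof -
  have inv: "horizontally_joined X x (x \<odot> f23_inv k) m" if "\<And>x. horizontally_joined X x (x \<odot> k) m" for x k m
    using horizontally_joined_sym[OF that[of "x \<odot> f23_inv k"]] by (simp add: f23_group)
  have "horizontally_joined X x (x \<odot> g \<odot> h \<odot> f23_inv g \<odot> f23_inv h) (l + l' + l + l')"
    by (rule horizontally_joined_trans[OF horizontally_joined_trans[OF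
          horizontally_joined_trans[OF g h] inv[OF g]] inv[OF h]])
  then show ?thesis by (simp add: f23_commutator_def f23_group)
qed

lemma f23_commutator_horizontal:
  assumes "g \<in> f23_V1" "h \<in> f23_V1"
  shows "f23_commutator g h $ 1 = 0" "f23_commutator g h $ 2 = 0"
    "f23_commutator g h $ 3 = g$2 * h$1 - g$1 * h$2"
  unfolding f23_commutator_def f23_inv_def
  by (simp_all only: f23_mult_nth vector_uminus_component) (simp_all add: algebra_simps)

lemma f23_commutator_central:
  assumes "g$1 = 0" "g$2 = 0" "h \<in> f23_V1"
  shows "f23_commutator g h = vector [0, 0, 0, g$3 * h$1, g$3 * h$2]"
  using assms unfolding f23_commutator_def f23_inv_def f23_V1_eq mem_Collect_eq
  by (intro f23_eqI; simp only: f23_mult_nth vector_uminus_component vector_5; simp add: field_simps)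

lemma f23_mult_central:
  assumes "z$1 = 0" "z$2 = 0" "z$3 = 0"
  shows "x \<odot> z = x + z"
  using assms by (intro f23_eqI; simp only: f23_mult_nth vector_add_component; simp)

text \<open>A third-layer element at scale \<open>t\<close> is the triple commutator of three horizontal elements of size \<open>t\<close>, so
  that ten segments of length \<open>O(t)\<close> reach it.\<close>
lemma horizontally_joined_central:
  assumes X: "horizontal_basis X"
  shows "\<exists>C>0. \<forall>t>0. \<forall>x. horizontally_joined X x (x \<odot> vector [0, 0, 0, t^3 * \<alpha>, t^3 * \<beta>]) (C * t)"
proof -
  define e1 e2 c :: "real^5" where "e1 = axis 1 1" and "e2 = axis 2 1" and "c = vector [\<alpha>, \<beta>, 0, 0, 0]"
  have V1: "e1 \<in> f23_V1" "e2 \<in> f23_V1" "c \<in> f23_V1"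
    unfolding f23_V1_eq e1_def e2_def c_def mem_Collect_eq by (simp_all only: f23_axis_nth vector_5 simp_thms)
  have V1': "t *\<^sub>R v \<in> f23_V1" if "v \<in> f23_V1" for t v
    using that by (simp add: f23_V1_def span_scale)
  define N where "N v = norm (horizontal_coords X v)" for v
  define C where "C = 4 * N e1 + 4 * N e2 + 2 * N c"
  have seg: "horizontally_joined X x (x \<odot> t *\<^sub>R v) (t * N v)" if "v \<in> f23_V1" "0 < t" for x t v
    using horizontally_joined_horizontal[OF X V1'[OF that(1)], of x t] that(2)
    by (simp add: horizontal_coords_scaleR N_def)
  have "horizontally_joined X x (x \<odot> vector [0, 0, 0, t^3 * \<alpha>, t^3 * \<beta>]) (C * t)" if t: "0 < t" for t x
  proof -
    define g where "g = f23_commutator (t *\<^sub>R e2) (t *\<^sub>R e1)"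
    have g: "g$1 = 0" "g$2 = 0" "g$3 = t\<^sup>2"
      unfolding g_def f23_commutator_horizontal[OF V1'[OF V1(2)] V1'[OF V1(1)]]
      by (simp only: e1_def e2_def vector_scaleR_component f23_axis_nth real_scaleR_def;
          simp add: power2_eq_square)+
    have "horizontally_joined X x (x \<odot> g) (t * N e2 + t * N e1 + t * N e2 + t * N e1)" for x
      unfolding g_def by (intro horizontally_joined_commutator seg V1 t)
    then have "horizontally_joined X x (x \<odot> f23_commutator g (t *\<^sub>R c))
        ((t * N e2 + t * N e1 + t * N e2 + t * N e1) + t * N c +
         (t * N e2 + t * N e1 + t * N e2 + t * N e1) + t * N c)"
      by (intro horizontally_joined_commutator seg V1 t)
    moreover have "f23_commutator g (t *\<^sub>R c) = vector [0, 0, 0, t^3 * \<alpha>, t^3 * \<beta>]"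
      using f23_commutator_central[OF g(1,2) V1'[OF V1(3), of t]]
      by (simp add: g(3) c_def power2_eq_square power3_eq_cube mult.assoc)
    ultimately show ?thesis by (simp add: C_def algebra_simps)
  qed
  moreover have "0 < C"
  proof -
    have "horizontal_coords X e1 \<noteq> 0"
    proof
      assume "horizontal_coords X e1 = 0"
      then have "e1 = 0" using horizontal_coords_expansion[OF X V1(1)] by simp
      then show False using f23_axis_nth(1) by (simp add: e1_def del: f23_axis_nth)
    qed
    then have "0 < N e1" "0 \<le> N e2" "0 \<le> N c" by (simp_all add: N_def)
    then show ?thesis by (simp add: C_def)
  qed
  ultimately show ?thesis by blast
qed

text \<open>Chow's theorem for this group. An element is the product of a horizontal element, which adjusts the
  first layer, a commutator of horizontal elements, which adjusts the second, and a third-layer element,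
  which is central and corrects the rest.\<close>
lemma horizontally_joined_exists:
  assumes X: "horizontal_basis X"
  shows "\<exists>l. horizontally_joined X x y l"
proof -
  define g where "g = f23_inv x \<odot> y"
  define h v where "h = (vector [g$1, g$2, 0, 0, 0] :: real^5)"
    and "v = f23_commutator (g$3 *\<^sub>R axis 2 1) (axis 1 1)"
  define k where "k = h \<odot> v"
  define z where "z = (vector [0, 0, 0, 1 ^ 3 * (g$4 - k$4), 1 ^ 3 * (g$5 - k$5)] :: real^5)"
  have e: "axis 1 1 \<in> f23_V1" "g$3 *\<^sub>R axis 2 1 \<in> f23_V1"
    unfolding f23_V1_def by (auto intro: span_base span_scale)
  have hV1: "h \<in> f23_V1" unfolding f23_V1_eq h_def by (simp only: mem_Collect_eq vector_5 simp_thms)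
  have v: "v$1 = 0" "v$2 = 0" "v$3 = g$3"
    unfolding v_def f23_commutator_horizontal[OF e(2,1)]
    by (simp_all del: One_nat_def)
  have k: "k$1 = g$1" "k$2 = g$2" "k$3 = g$3"
    unfolding k_def f23_mult_nth v by (simp_all add: h_def)
  have "k \<odot> z = k + z" by (rule f23_mult_central) (simp_all add: z_def)
  also have "\<dots> = g" by (rule f23_eqI) (simp_all add: k z_def)
  finally have "x \<odot> h \<odot> v \<odot> z = x \<odot> g" by (simp add: k_def f23_group)
  also have "\<dots> = y" unfolding g_def by (simp add: f23_group(4,5,2) flip: f23_group(1))
  finally have y: "x \<odot> h \<odot> v \<odot> z = y" .
  have 1: "horizontally_joined X x (x \<odot> h) (norm (horizontal_coords X h))"
    by (rule horizontally_joined_horizontal[OF X hV1])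
  have 2: "\<exists>l. \<forall>x. horizontally_joined X x (x \<odot> v) l"
    using horizontally_joined_commutator[OF horizontally_joined_horizontal[OF X e(2)] horizontally_joined_horizontal[OF X e(1)]]
    unfolding v_def by blast
  have 3: "\<exists>l. \<forall>x. horizontally_joined X x (x \<odot> z) l"
    using horizontally_joined_central[OF X, of "g$4 - k$4" "g$5 - k$5"] zero_less_one unfolding z_def by blast
  from 1 2 3 show ?thesis unfolding y[symmetric] by (meson horizontally_joined_trans)
qed

section \<open>The transverse moment along horizontal curves\<close>

lemma horizontal_curve_FTC:
  fixes f :: "real^5 \<Rightarrow> real"
  assumes \<gamma>: "horizontal_curve X a b \<gamma> u"
    and AC: "absolutely_continuous_curve a b (\<lambda>t. f (\<gamma> t))"
    and chain: "\<And>t T. (\<gamma> has_vector_derivative horizontal_velocity X (u t) (\<gamma> t)) (at t within T)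
      \<Longrightarrow> ((\<lambda>t. f (\<gamma> t)) has_vector_derivative g t) (at t within T)"
    and st: "a \<le> s" "s \<le> t" "t \<le> b"
  shows "(g has_integral (f (\<gamma> t) - f (\<gamma> s))) {s..t}"
proof -
  obtain S where S: "negligible S" "\<And>r. r \<in> {a..b} - S \<Longrightarrow>
      (\<gamma> has_vector_derivative horizontal_velocity X (u r) (\<gamma> r)) (at r within {a..b})"
    using \<gamma> by (auto simp: horizontal_curve_iff)
  show ?thesis
  proof (rule absolutely_continuous_curve_FTC[OF st(2) _ S(1)])
    show "absolutely_continuous_curve s t (\<lambda>t. f (\<gamma> t))"
      by (rule absolutely_continuous_curve_subinterval[OF AC st(1,3)])
    fix r assume r: "r \<in> {s..t} - S"
    have "{s..t} \<subseteq> {a..b}" using st by auto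
    with r have "(\<gamma> has_vector_derivative horizontal_velocity X (u r) (\<gamma> r)) (at r within {s..t})"
      by (intro has_vector_derivative_within_subset[OF S(2)]) auto
    then show "((\<lambda>t. f (\<gamma> t)) has_vector_derivative g r) (at r within {s..t})" by (rule chain)
  qed
qed

definition along :: "(2 \<Rightarrow> real^5) \<Rightarrow> real^5 \<Rightarrow> real^5 \<Rightarrow> real" where
  "along X E x = horizontal_coords X E \<bullet> horizontal_coords X x"

text \<open>The area form with \<open>E\<close>: up to a constant factor, the coordinate orthogonal to \<open>E\<close> in the horizontal
  layer, for whichever inner product is chosen.\<close>
definition across :: "real^5 \<Rightarrow> real^5 \<Rightarrow> real" where
  "across E x = x$2 * E$1 - x$1 * E$2"

text \<open>A primitive, along horizontal curves, of \<open>Q\<^sup>2 P'\<close> for \<open>P = along X E\<close> and \<open>Q = across E\<close>, if \<open>E\<close> is a unit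
  vector. The first summand sees the third layer only; the others remove from its derivative all terms except the desired one.\<close>
definition transverse_moment :: "(2 \<Rightarrow> real^5) \<Rightarrow> real^5 \<Rightarrow> real^5 \<Rightarrow> real" where
  "transverse_moment X E x =
     - 2 * (E$1 * x$5 - E$2 * x$4) + across E x * x$3 + 1 / 3 * along X E x * (across E x)\<^sup>2"

lemma bounded_linear_along: "bounded_linear (along X E)"
proof -
  have "bounded_linear (horizontal_coords X)"
    by (rule linear_conv_bounded_linear[THEN iffD1, OF linear_horizontal_coords])
  then show ?thesis
    unfolding along_def[abs_def] by (rule bounded_linear_inner_right_comp)
qed

lemma bounded_linear_across: "bounded_linear (across E)"
  unfolding across_def[abs_def] linear_conv_bounded_linear[symmetric]
  by (rule linearI) (simp_all add: algebra_simps)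

lemma along_velocity:
  assumes "horizontal_basis X"
  shows "along X E (horizontal_velocity X v p) = horizontal_coords X E \<bullet> v"
proof -
  let ?Y = "\<Sum>j\<in>UNIV. v $ j *\<^sub>R X j"
  have "horizontal_velocity X v p $ 1 = ?Y $ 1" "horizontal_velocity X v p $ 2 = ?Y $ 2"
    unfolding horizontal_velocity_eq left_invariant_field_eq
    by (simp_all only: vector_add_component vector_scaleR_component f23_bracket_nth) simp_all
  then have "horizontal_coords X (horizontal_velocity X v p) = horizontal_coords X ?Y"
    by (rule horizontal_coords_cong)
  also have "\<dots> = v" by (rule horizontal_coords_combination[OF assms])
  finally have "horizontal_coords X (horizontal_velocity X v p) = v" .
  then show ?thesis by (simp add: along_def)
qed

lemma across_velocity: "across E (horizontal_velocity X v p) = across E (X 1) * v$1 + across E (X 2) * v$2"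
  unfolding horizontal_velocity_eq left_invariant_field_eq across_def UNIV_2
  by (simp only: vector_add_component vector_scaleR_component f23_bracket_nth sum_component)
    (simp add: algebra_simps)

text \<open>Both sides are alternating bilinear forms on a plane, hence proportional. This is what expresses the
  third coordinate of a horizontal velocity in terms of \<open>along\<close> and \<open>across\<close>.\<close>
lemma area_form_along_across:
  assumes X: "horizontal_basis X"
  shows "across E x * along X E y - along X E x * across E y =
    (norm (horizontal_coords X E))\<^sup>2 * (x$2 * y$1 - x$1 * y$2)"
proof -
  have c: "z$1 = horizontal_coords X z $ 1 * X 1 $ 1 + horizontal_coords X z $ 2 * X 2 $ 1"
    "z$2 = horizontal_coords X z $ 1 * X 1 $ 2 + horizontal_coords X z $ 2 * X 2 $ 2" for z
  proof -
    let ?z = "vector [z$1, z$2, 0, 0, 0] :: real^5"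
    have "?z \<in> f23_V1" unfolding f23_V1_eq by (simp only: mem_Collect_eq vector_5 simp_thms)
    moreover have "horizontal_coords X ?z = horizontal_coords X z" by (rule horizontal_coords_cong) simp_all
    ultimately have e: "horizontal_coords X z $ 1 *\<^sub>R X 1 + horizontal_coords X z $ 2 *\<^sub>R X 2 = ?z"
      using horizontal_coords_expansion[OF X, of ?z] by (simp add: UNIV_2)
    show "z$1 = horizontal_coords X z $ 1 * X 1 $ 1 + horizontal_coords X z $ 2 * X 2 $ 1"
      "z$2 = horizontal_coords X z $ 1 * X 1 $ 2 + horizontal_coords X z $ 2 * X 2 $ 2"
      using arg_cong[OF e, of "\<lambda>v. v$1"] arg_cong[OF e, of "\<lambda>v. v$2"] by simp_all
  qed
  have n: "(norm (horizontal_coords X E))\<^sup>2 = (horizontal_coords X E $ 1)\<^sup>2 + (horizontal_coords X E $ 2)\<^sup>2"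
    unfolding power2_norm_eq_inner by (simp add: inner_vec_def UNIV_2 power2_eq_square)
  show ?thesis
    unfolding along_def across_def n inner_vec_def UNIV_2 c[of x] c[of y] c[of E]
    by (simp add: algebra_simps power2_eq_square)
qed

lemma transverse_moment_derivative:
  assumes X: "horizontal_basis X" and E: "norm (horizontal_coords X E) = 1"
    and \<gamma>: "(\<gamma> has_vector_derivative horizontal_velocity X v (\<gamma> t)) (at t within T)"
  shows "((\<lambda>t. transverse_moment X E (\<gamma> t)) has_vector_derivative
    (across E (\<gamma> t))\<^sup>2 * (horizontal_coords X E \<bullet> v)) (at t within T)"
proof -
  define Y where "Y = (\<Sum>j\<in>UNIV. v $ j *\<^sub>R X j)"
  define V where "V = horizontal_velocity X v (\<gamma> t)"
  define p where "p = \<gamma> t"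
  have Y: "Y$3 = 0" "Y$4 = 0" "Y$5 = 0"
    by (simp_all add: Y_def UNIV_2 horizontal_basis_in_V1(2-)[OF X])
  have V: "V$1 = Y$1" "V$2 = Y$2" "V$3 = (p$2 * Y$1 - p$1 * Y$2) / 2"
    "V$4 = p$3 * Y$1 / 2 - p$1 * (p$2 * Y$1 - p$1 * Y$2) / 12"
    "V$5 = p$3 * Y$2 / 2 - p$2 * (p$2 * Y$1 - p$1 * Y$2) / 12"
    unfolding V_def horizontal_velocity_eq left_invariant_field_eq Y_def[symmetric] p_def[symmetric]
    by (simp_all only: vector_add_component vector_scaleR_component f23_bracket_nth Y)
      (simp_all add: field_simps)
  have lin: "((\<lambda>t. L (\<gamma> t)) has_real_derivative L V) (at t within T)" if "bounded_linear L" for L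
    using bounded_linear.has_vector_derivative[OF that \<gamma>]
    by (simp add: V_def has_real_derivative_iff_has_vector_derivative)
  note comp = lin[OF bounded_linear_vec_nth] lin[OF bounded_linear_across[of E]] lin[OF bounded_linear_along[of X E]]
  have "((\<lambda>t. transverse_moment X E (\<gamma> t)) has_real_derivative
     - 2 * (E$1 * V$5 - E$2 * V$4) + (across E V * p$3 + across E p * V$3)
      + 1 / 3 * (along X E V * (across E p)\<^sup>2 + along X E p * (2 * across E p * across E V))) (at t within T)"
    unfolding transverse_moment_def
    by (auto intro!: derivative_eq_intros comp simp: p_def algebra_simps)
  also have "- 2 * (E$1 * V$5 - E$2 * V$4) + (across E V * p$3 + across E p * V$3)
      + 1 / 3 * (along X E V * (across E p)\<^sup>2 + along X E p * (2 * across E p * across E V))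
      = (across E p)\<^sup>2 * along X E V"
  proof -
    define A where "A = p$2 * Y$1 - p$1 * Y$2"
    have aV: "across E V = across E Y" by (simp add: across_def V)
    have "across E p * along X E V - along X E p * across E Y = A"
      using area_form_along_across[OF X, of E p V] by (simp add: E A_def V across_def)
    then have "2 / 3 * across E p * (across E p * along X E V - along X E p * across E Y) = 2 / 3 * (across E p * A)"
      by simp
    moreover have "1 / 3 * (along X E V * (across E p)\<^sup>2 + along X E p * (2 * across E p * across E Y)) =
        (across E p)\<^sup>2 * along X E V
        - 2 / 3 * across E p * (across E p * along X E V - along X E p * across E Y)"
      by (simp add: algebra_simps power2_eq_square)
    moreover have "- 2 * (E$1 * V$5 - E$2 * V$4) = across E p * A / 6 - p$3 * across E Y"
      unfolding V A_def[symmetric] by (simp add: across_def field_simps)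
    moreover have "across E p * V$3 = across E p * A / 2" by (simp add: V A_def)
    moreover have "p$3 * across E Y = across E Y * p$3" by simp
    ultimately show ?thesis
      unfolding aV by linarith
  qed
  also have "along X E V = horizontal_coords X E \<bullet> v"
    unfolding V_def by (rule along_velocity[OF X])
  finally show ?thesis by (simp add: has_real_derivative_iff_has_vector_derivative p_def)
qed

lemma along_increment:
  assumes X: "horizontal_basis X" and \<gamma>: "horizontal_curve X a b \<gamma> u"
  shows "((\<lambda>t. horizontal_coords X E \<bullet> u t) has_integral (along X E (\<gamma> b) - along X E (\<gamma> a))) {a..b}"
proof (rule horizontal_curve_FTC[where f = "along X E", OF \<gamma>])
  show "absolutely_continuous_curve a b (\<lambda>t. along X E (\<gamma> t))"
    by (rule absolutely_continuous_curve_linear[OF bounded_linear_along])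
      (use \<gamma> in \<open>simp add: horizontal_curve_iff\<close>)
  show "((\<lambda>t. along X E (\<gamma> t)) has_vector_derivative horizontal_coords X E \<bullet> u t) (at t within T)"
    if "(\<gamma> has_vector_derivative horizontal_velocity X (u t) (\<gamma> t)) (at t within T)" for t T
    using bounded_linear.has_vector_derivative[OF bounded_linear_along that, of X E] along_velocity[OF X] by simp
qed (use \<gamma> in \<open>simp_all add: horizontal_curve_iff\<close>)

text \<open>By the Cauchy-Schwarz inequality the speed in direction \<open>E\<close> is at most the total speed.\<close>
lemma along_le_length:
  assumes X: "horizontal_basis X" and E: "norm (horizontal_coords X E) = 1"
    and "horizontally_joined X x y l"
  shows "along X E x - along X E y \<le> l"
proof -
  obtain a b \<gamma> u where *: "horizontal_curve X a b \<gamma> u" "\<gamma> a = x" "\<gamma> b = y"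
    "((\<lambda>t. norm (u t)) has_integral l) {a..b}"
    using assms(3) by (auto simp: horizontally_joined_def)
  have "((\<lambda>t. - (horizontal_coords X E \<bullet> u t)) has_integral (- (along X E y - along X E x))) {a..b}"
    using has_integral_neg[OF along_increment[OF X *(1), of E]] by (simp add: *)
  then have "- (along X E y - along X E x) \<le> l"
  proof (rule has_integral_le[OF _ *(4)])
    show "- (horizontal_coords X E \<bullet> u t) \<le> norm (u t)" for t
      using Cauchy_Schwarz_ineq2[of "horizontal_coords X E" "u t"] by (simp add: E abs_le_iff)
  qed
  then show ?thesis by simp
qed

text \<open>The difference \<open>l - (along X E x - along X E y)\<close> is the length in excess of what the displacement against
  \<open>E\<close> requires. The estimate is \<open>turning_back_estimate\<close> for the preferred direction \<open>- E\<close>.\<close>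
lemma transverse_moment_increment_le:
  assumes X: "horizontal_basis X" and E: "norm (horizontal_coords X E) = 1"
  shows "\<exists>C>0. \<forall>x y l. horizontally_joined X x y l \<longrightarrow> across E y = 0 \<longrightarrow>
    transverse_moment X E y - transverse_moment X E x \<le> C * (l - (along X E x - along X E y)) ^ 3"
proof -
  \<comment> \<open>The summand 1 only makes \<open>K\<close> positive.\<close>
  define K where "K = \<bar>across E (X 1)\<bar> + \<bar>across E (X 2)\<bar> + 1"
  have "0 < K" by (simp add: K_def)
  have "transverse_moment X E y - transverse_moment X E x \<le> 27 * K\<^sup>2 * (l - (along X E x - along X E y)) ^ 3"
    if joined: "horizontally_joined X x y l" and y0: "across E y = 0" for x y l
  proof -
    obtain a b \<gamma> u where \<gamma>: "horizontal_curve X a b \<gamma> u" "\<gamma> a = x" "\<gamma> b = y"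
      and len: "((\<lambda>t. norm (u t)) has_integral l) {a..b}"
      using joined by (auto simp: horizontally_joined_def)
    have ab: "a \<le> b" and AC: "absolutely_continuous_curve a b \<gamma>"
      using \<gamma>(1) by (auto simp: horizontal_curve_iff)
    have ACq: "absolutely_continuous_curve a b (\<lambda>t. across E (\<gamma> t))"
      by (rule absolutely_continuous_curve_linear[OF bounded_linear_across AC])
    have ACd: "absolutely_continuous_curve a b (\<lambda>t. transverse_moment X E (\<gamma> t))"
    proof -
      have "bounded_linear (\<lambda>x::real^5. - 2 * (E$1 * x$5 - E$2 * x$4))"
        unfolding linear_conv_bounded_linear[symmetric] by (rule linearI) (simp_all add: algebra_simps)
      then show ?thesis
        unfolding transverse_moment_def power2_eq_square
        by (intro absolutely_continuous_curve_add absolutely_continuous_curve_mult ACq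
            absolutely_continuous_curve_const absolutely_continuous_curve_linear[OF _ AC]
            absolutely_continuous_curve_linear[OF bounded_linear_along AC] bounded_linear_vec_nth)
    qed
    have w: "((\<lambda>t. - (horizontal_coords X E \<bullet> u t)) has_integral (along X E x - along X E y)) {a..b}"
      using has_integral_neg[OF along_increment[OF X \<gamma>(1), of E]] by (simp add: \<gamma>)
    have var: "\<bar>across E (\<gamma> t) - across E (\<gamma> s)\<bar> \<le> K * integral {s..t} (\<lambda>t. norm (u t))"
      if st: "a \<le> s" "s \<le> t" "t \<le> b" for s t
    proof -
      have i: "((\<lambda>t. across E (X 1) * u t $ 1 + across E (X 2) * u t $ 2) has_integral
          (across E (\<gamma> t) - across E (\<gamma> s))) {s..t}"
      proof (rule horizontal_curve_FTC[where f = "across E", OF \<gamma>(1) ACq _ st])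
        show "((\<lambda>t. across E (\<gamma> t)) has_vector_derivative across E (X 1) * u t $ 1 + across E (X 2) * u t $ 2) (at t within T)"
          if "(\<gamma> has_vector_derivative horizontal_velocity X (u t) (\<gamma> t)) (at t within T)" for t T
          using bounded_linear.has_vector_derivative[OF bounded_linear_across that, of E] by (simp add: across_velocity)
      qed
      have n: "(\<lambda>t. norm (u t)) integrable_on {s..t}"
        using len st by (meson has_integral_integrable integrable_on_subinterval atLeastatMost_subset_iff)
      have "norm (integral {s..t} (\<lambda>t. across E (X 1) * u t $ 1 + across E (X 2) * u t $ 2))
          \<le> integral {s..t} (\<lambda>t. K * norm (u t))"
      proof (rule integral_norm_bound_integral)
        show "(\<lambda>t. across E (X 1) * u t $ 1 + across E (X 2) * u t $ 2) integrable_on {s..t}"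
          using i by (rule has_integral_integrable)
        show "(\<lambda>t. K * norm (u t)) integrable_on {s..t}"
          using integrable_cmul[OF n, of K] by simp
        fix t
        have "\<bar>across E (X 1) * u t $ 1\<bar> \<le> \<bar>across E (X 1)\<bar> * norm (u t)"
          "\<bar>across E (X 2) * u t $ 2\<bar> \<le> \<bar>across E (X 2)\<bar> * norm (u t)"
          using component_le_norm_cart[of "u t"] by (auto simp: abs_mult intro!: mult_left_mono)
        moreover have "K * norm (u t) = \<bar>across E (X 1)\<bar> * norm (u t) + \<bar>across E (X 2)\<bar> * norm (u t) + norm (u t)"
          by (simp add: K_def algebra_simps)
        ultimately show "norm (across E (X 1) * u t $ 1 + across E (X 2) * u t $ 2) \<le> K * norm (u t)"
          using norm_ge_zero[of "u t"] unfolding real_norm_def by linarith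
      qed
      then show ?thesis using i by (simp add: integral_unique)
    qed
    have *: "((\<lambda>t. (across E (\<gamma> t))\<^sup>2 * (horizontal_coords X E \<bullet> u t)) has_integral
        (transverse_moment X E (\<gamma> b) - transverse_moment X E (\<gamma> a))) {a..b}"
      by (rule horizontal_curve_FTC[where f = "transverse_moment X E", OF \<gamma>(1) ACd
            transverse_moment_derivative[OF X E]]) (use ab in auto)
    have J: "((\<lambda>t. (across E (\<gamma> t))\<^sup>2 * - (horizontal_coords X E \<bullet> u t)) has_integral
        - (transverse_moment X E y - transverse_moment X E x)) {a..b}"
      using has_integral_neg[OF *] by (simp add: \<gamma>)
    have "- (- (transverse_moment X E y - transverse_moment X E x)) \<le> 27 * K\<^sup>2 * (l - (along X E x - along X E y)) ^ 3"
    proof (rule turning_back_estimate[OF ab w len _ _ _ \<open>0 < K\<close> var J])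
      show "\<bar>- (horizontal_coords X E \<bullet> u t)\<bar> \<le> norm (u t)" for t
        using Cauchy_Schwarz_ineq2[of "horizontal_coords X E" "u t"] by (simp add: E)
      show "continuous_on {a..b} (\<lambda>t. across E (\<gamma> t))"
        by (rule absolutely_continuous_curve_imp_continuous_on[OF ACq])
    qed (simp_all add: \<gamma> y0)
    then show ?thesis by simp
  qed
  then show ?thesis using \<open>0 < K\<close> by (intro exI[of _ "27 * K\<^sup>2"]) auto
qed

section \<open>The Carnot-Caratheodory distance\<close>

text \<open>Chow's theorem is needed here, since the infimum of the empty set is unspecified.\<close>
lemma cc_dist_ge:
  assumes "horizontal_basis X" "\<And>l. horizontally_joined X x y l \<Longrightarrow> c \<le> l"
  shows "c \<le> cc_dist X x y"
  unfolding cc_dist_eq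
  by (rule cInf_greatest) (use assms horizontally_joined_exists in blast)+

lemma cc_dist_triangle:
  assumes X: "horizontal_basis X"
  shows "cc_dist X x z \<le> cc_dist X x y + cc_dist X y z"
proof -
  have "cc_dist X x z - l' \<le> cc_dist X x y" if "horizontally_joined X y z l'" for l'
  proof (rule cc_dist_ge[OF X])
    fix l assume "horizontally_joined X x y l"
    from cc_dist_le[OF horizontally_joined_trans[OF this that]] show "cc_dist X x z - l' \<le> l" by simp
  qed
  then have "cc_dist X x z - cc_dist X x y \<le> cc_dist X y z"
    by (intro cc_dist_ge[OF X]) (simp add: algebra_simps)
  then show ?thesis by simp
qed

lemma cc_dist_ray:
  assumes X: "horizontal_basis X" and E: "E \<in> f23_V1" "norm (horizontal_coords X E) = 1" and "0 \<le> s"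
  shows "cc_dist X (s *\<^sub>R E) 0 = s"
proof (rule antisym)
  have "- (s *\<^sub>R E) \<in> f23_V1" using E(1) by (simp add: f23_V1_def span_neg span_scale)
  from horizontally_joined_horizontal[OF X this, of "s *\<^sub>R E"]
  have "horizontally_joined X (s *\<^sub>R E) 0 s"
    using f23_group(5)[of "s *\<^sub>R E"] \<open>0 \<le> s\<close>
    by (simp add: f23_inv_def horizontal_coords_minus horizontal_coords_scaleR E(2))
  then show "cc_dist X (s *\<^sub>R E) 0 \<le> s" by (rule cc_dist_le)
  show "s \<le> cc_dist X (s *\<^sub>R E) 0"
  proof (rule cc_dist_ge[OF X])
    fix l assume "horizontally_joined X (s *\<^sub>R E) 0 l"
    from along_le_length[OF X E(2) this] show "s \<le> l"
      using E(2) by (simp add: along_def horizontal_coords_scaleR linear_0[OF linear_horizontal_coords] dot_square_norm)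
  qed
qed

section \<open>Lengthening forced by a third-layer shift\<close>

text \<open>The dilation by \<open>t\<close> of a third-layer element. Its direction is chosen such that a curve from
  \<open>exp (s E)\<close> times it to the identity has to increase the transverse moment.\<close>
definition central_shift :: "real^5 \<Rightarrow> real \<Rightarrow> real^5" where
  "central_shift E t = vector [0, 0, 0, t ^ 3 * - E$2, t ^ 3 * E$1]"

lemma central_shift_nth [simp]:
  "central_shift E t $ 1 = 0" "central_shift E t $ 2 = 0" "central_shift E t $ 3 = 0"
  "central_shift E t $ 4 = t ^ 3 * - E$2" "central_shift E t $ 5 = t ^ 3 * E$1"
  by (simp_all add: central_shift_def)

lemma
  assumes E: "E \<in> f23_V1" "norm (horizontal_coords X E) = 1"
  shows along_central_shift: "along X E (s *\<^sub>R E \<odot> central_shift E t) = s"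
    and across_central_shift: "across E (s *\<^sub>R E \<odot> central_shift E t) = 0"
    and transverse_moment_central_shift:
      "transverse_moment X E (s *\<^sub>R E \<odot> central_shift E t) = - (2 * ((E$1)\<^sup>2 + (E$2)\<^sup>2) * t ^ 3)"
proof -
  have eq: "s *\<^sub>R E \<odot> central_shift E t = s *\<^sub>R E + central_shift E t"
    by (rule f23_mult_central) simp_all
  have E0: "E$3 = 0" "E$4 = 0" "E$5 = 0" using E(1) unfolding f23_V1_eq by auto
  have "horizontal_coords X (s *\<^sub>R E \<odot> central_shift E t) = horizontal_coords X (s *\<^sub>R E)"
    by (rule horizontal_coords_cong) (simp_all add: eq)
  then show "along X E (s *\<^sub>R E \<odot> central_shift E t) = s"
    by (simp add: along_def horizontal_coords_scaleR dot_square_norm E(2))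
  show 2: "across E (s *\<^sub>R E \<odot> central_shift E t) = 0"
    by (simp add: eq across_def)
  show "transverse_moment X E (s *\<^sub>R E \<odot> central_shift E t) = - (2 * ((E$1)\<^sup>2 + (E$2)\<^sup>2) * t ^ 3)"
    unfolding transverse_moment_def 2 by (simp add: eq E0 algebra_simps power2_eq_square)
qed

lemma transverse_moment_line:
  assumes "E \<in> f23_V1"
  shows "across E (s *\<^sub>R E) = 0" "transverse_moment X E (s *\<^sub>R E) = 0"
proof -
  have E0: "E$3 = 0" "E$4 = 0" "E$5 = 0" using assms unfolding f23_V1_eq by auto
  show "across E (s *\<^sub>R E) = 0" by (simp add: across_def)
  then show "transverse_moment X E (s *\<^sub>R E) = 0" by (simp add: transverse_moment_def E0)
qed

text \<open>Curves that travel from \<open>exp (s E)\<close> to the shifted point decrease the moment for \<open>E\<close>, so that the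
  increment estimate is applied to them for \<open>- E\<close>.\<close>
lemma minus_direction:
  "along X (- E) x = - along X E x" "across (- E) x = - across E x"
  "transverse_moment X (- E) x = - transverse_moment X E x"
proof -
  show along: "along X (- E) x = - along X E x" and across: "across (- E) x = - across E x"
    by (simp_all add: along_def across_def horizontal_coords_minus)
  show "transverse_moment X (- E) x = - transverse_moment X E x"
    unfolding transverse_moment_def along across by simp
qed

text \<open>Both bounds compare the moment of the shifted point, a multiple of \<open>t\<^sup>3\<close>, with the cube of an excess
  length. The second bound serves to make the denominator in the definition of differentiability
  positive: at a vanishing denominator the quotient would be zero by convention.\<close>
lemma central_shift_excess_length:
  assumes X: "horizontal_basis X" and E: "E \<in> f23_V1" "norm (horizontal_coords X E) = 1"
  shows "\<exists>c>0. \<forall>t>0. \<forall>s. s + c * t \<le> cc_dist X (s *\<^sub>R E \<odot> central_shift E t) 0 \<and>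
    c * t \<le> cc_dist X (s *\<^sub>R E) (s *\<^sub>R E \<odot> central_shift E t)"
proof -
  define m where "m = (E$1)\<^sup>2 + (E$2)\<^sup>2"
  have "0 < m"
  proof -
    have "E$1 \<noteq> 0 \<or> E$2 \<noteq> 0"
    proof (rule ccontr)
      assume "\<not> (E$1 \<noteq> 0 \<or> E$2 \<noteq> 0)"
      then have "horizontal_coords X E = horizontal_coords X 0" by (intro horizontal_coords_cong) auto
      then show False using E(2) by (simp add: linear_0[OF linear_horizontal_coords])
    qed
    then show ?thesis by (auto simp: m_def add_pos_nonneg add_nonneg_pos)
  qed
  have E': "norm (horizontal_coords X (- E)) = 1" by (simp add: horizontal_coords_minus E(2))
  obtain C1 where C1: "0 < C1" "\<And>x y l. \<lbrakk>horizontally_joined X x y l; across E y = 0\<rbrakk> \<Longrightarrow>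
      transverse_moment X E y - transverse_moment X E x \<le> C1 * (l - (along X E x - along X E y)) ^ 3"
    using transverse_moment_increment_le[OF X E(2)] by meson
  obtain C2 where C2: "0 < C2" "\<And>x y l. \<lbrakk>horizontally_joined X x y l; across (- E) y = 0\<rbrakk> \<Longrightarrow>
      transverse_moment X (- E) y - transverse_moment X (- E) x \<le> C2 * (l - (along X (- E) x - along X (- E) y)) ^ 3"
    using transverse_moment_increment_le[OF X E'] by meson
  define C where "C = max C1 C2"
  define c where "c = root 3 (2 * m / C)"
  have "0 < C" using C1(1) by (simp add: C_def)
  then have c: "0 < c" "c ^ 3 = 2 * m / C" using \<open>0 < m\<close> by (simp_all add: c_def)
  \<comment> \<open>The constant \<open>c\<close> turns the cubic estimate of \<open>t\<^sup>3\<close> into a linear one of \<open>t\<close>.\<close>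
  have cube: "c * t \<le> \<delta>" if "0 \<le> \<delta>" "0 < t" "2 * m * t ^ 3 \<le> C * \<delta> ^ 3" for \<delta> t
  proof (rule ccontr)
    assume "\<not> c * t \<le> \<delta>"
    then have "\<delta> ^ 3 < (c * t) ^ 3" using that(1) by (intro power_strict_mono) auto
    then have "C * \<delta> ^ 3 < C * (c * t) ^ 3" using \<open>0 < C\<close> by simp
    also have "\<dots> = 2 * m * t ^ 3" using \<open>0 < C\<close> by (simp add: power_mult_distrib c(2))
    finally show False using that(3) by simp
  qed
  have "s + c * t \<le> cc_dist X (s *\<^sub>R E \<odot> central_shift E t) 0 \<and>
    c * t \<le> cc_dist X (s *\<^sub>R E) (s *\<^sub>R E \<odot> central_shift E t)" if t: "0 < t" for t s
  proof
    let ?y = "s *\<^sub>R E \<odot> central_shift E t"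
    note y = along_central_shift[OF E, where s = s and t = t] across_central_shift[OF E, where s = s and t = t]
      transverse_moment_central_shift[OF E, where s = s and t = t]
    show "s + c * t \<le> cc_dist X ?y 0"
    proof (rule cc_dist_ge[OF X])
      fix l assume l: "horizontally_joined X ?y 0 l"
      have zero: "along X E 0 = 0" "across E 0 = 0" "transverse_moment X E 0 = 0"
        using transverse_moment_line[OF E(1), where s = 0] by (simp_all add: along_def linear_0[OF linear_horizontal_coords])
      have "0 \<le> l - s" using along_le_length[OF X E(2) l] by (simp add: y zero)
      moreover have "2 * m * t ^ 3 \<le> C1 * (l - s) ^ 3"
        using C1(2)[OF l zero(2)] by (simp add: y zero m_def)
      moreover have "C1 * (l - s) ^ 3 \<le> C * (l - s) ^ 3"
        using \<open>0 \<le> l - s\<close> by (intro mult_right_mono) (simp_all add: C_def)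
      ultimately have "c * t \<le> l - s" using cube t by (meson order.trans)
      then show "s + c * t \<le> l" by simp
    qed
    show "c * t \<le> cc_dist X (s *\<^sub>R E) ?y"
    proof (rule cc_dist_ge[OF X])
      fix l assume l: "horizontally_joined X (s *\<^sub>R E) ?y l"
      have x: "along X E (s *\<^sub>R E) = s" "transverse_moment X E (s *\<^sub>R E) = 0"
        using transverse_moment_line[OF E(1), where s = s] E(2)
        by (simp_all add: along_def horizontal_coords_scaleR dot_square_norm)
      have "across (- E) ?y = 0" by (simp add: minus_direction y)
      from C2(2)[OF l this] have "2 * m * t ^ 3 \<le> C2 * l ^ 3"
        by (simp add: minus_direction x y m_def)
      moreover have "0 \<le> l" by (rule horizontally_joined_nonneg[OF l])
      moreover have "C2 * l ^ 3 \<le> C * l ^ 3"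
        using \<open>0 \<le> l\<close> by (intro mult_right_mono) (simp_all add: C_def)
      ultimately show "c * t \<le> l" using cube t by (meson order.trans)
    qed
  qed
  with c(1) show ?thesis by blast
qed

section \<open>Non-differentiability\<close>

text \<open>The dilation by 2 multiplies a third-layer element by 8, that is, replaces it by its eighth power in
  the group; homogeneity and additivity of \<open>L\<close> thus give \<open>2 L z = 8 L z\<close>.\<close>
lemma G_linear_central:
  assumes L: "G_linear L" and z: "z$1 = 0" "z$2 = 0" "z$3 = 0"
  shows "L z = 0"
proof -
  have double: "L (v + v) = L v + L v" if "v$1 = 0" "v$2 = 0" "v$3 = 0" for v
    using L f23_mult_central[OF that, of v] unfolding G_linear_def by metis
  define a b where "a = z + z" and "b = a + a"
  have "L a = 2 * L z" "L b = 2 * L a" "L (b + b) = 2 * L b"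
    using double[of z] double[of a] double[of b] z by (simp_all add: a_def b_def)
  moreover have "f23_dilation 2 z = b + b"
    using z unfolding a_def b_def
    by (intro f23_eqI; simp only: f23_dilation_nth vector_add_component; simp)
  moreover have "L (f23_dilation 2 z) = 2 * L z" using L by (simp add: G_linear_def)
  ultimately show ?thesis by simp
qed

text \<open>Along \<open>t \<mapsto> exp (s E)\<close> times the central shift the numerator of the difference quotient is at least \<open>c t\<close>
  and the denominator at most \<open>C t\<close>. The case \<open>s = 0\<close> is the identity element.\<close>
theorem cc_dist_not_pansu_differentiable:
  assumes X: "horizontal_basis X" and E: "E \<in> f23_V1" "norm (horizontal_coords X E) = 1" and "0 \<le> s"
  shows "\<not> pansu_differentiable X (\<lambda>x. cc_dist X x 0) (s *\<^sub>R E)"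
proof
  assume "pansu_differentiable X (\<lambda>x. cc_dist X x 0) (s *\<^sub>R E)"
  then obtain L where L: "G_linear L" and lim:
    "((\<lambda>y. \<bar>cc_dist X y 0 - cc_dist X (s *\<^sub>R E) 0 - L (f23_inv (s *\<^sub>R E) \<odot> y)\<bar> / cc_dist X (s *\<^sub>R E) y)
      \<longlongrightarrow> 0) (at (s *\<^sub>R E))"
    unfolding pansu_differentiable_def by blast
  define y where "y t = s *\<^sub>R E \<odot> central_shift E t" for t
  obtain c where "0 < c" and c: "\<And>t. 0 < t \<Longrightarrow> s + c * t \<le> cc_dist X (y t) 0"
      "\<And>t. 0 < t \<Longrightarrow> c * t \<le> cc_dist X (s *\<^sub>R E) (y t)"
    using central_shift_excess_length[OF X E] unfolding y_def by metis
  obtain C where "0 < C" and C: "\<And>t. 0 < t \<Longrightarrow> cc_dist X (s *\<^sub>R E) (y t) \<le> C * t"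
    using horizontally_joined_central[OF X, of "- E$2" "E$1"] cc_dist_le
    unfolding y_def central_shift_def by metis
  have yeq: "y t = s *\<^sub>R E + central_shift E t" for t
    unfolding y_def by (rule f23_mult_central) simp_all
  have "filterlim y (at (s *\<^sub>R E)) (at_right 0)"
    unfolding filterlim_at
  proof
    have "((\<lambda>t. y t $ i) \<longlongrightarrow> (s *\<^sub>R E) $ i) (at_right 0)" for i
    proof -
      have "((\<lambda>t::real. (s *\<^sub>R E) $ i + t ^ 3 * (central_shift E 1 $ i)) \<longlongrightarrow> (s *\<^sub>R E) $ i + 0 ^ 3 * (central_shift E 1 $ i)) (at_right 0)"
        by (intro tendsto_intros)
      moreover have "y t $ i = (s *\<^sub>R E) $ i + t ^ 3 * (central_shift E 1 $ i)" for t
        unfolding yeq vector_add_component using exhaust_5[of i] by auto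
      ultimately show ?thesis by simp
    qed
    then show "(y \<longlongrightarrow> s *\<^sub>R E) (at_right 0)" by (rule vec_tendstoI)
    have "y t \<noteq> s *\<^sub>R E" if "0 < t" for t
    proof
      assume "y t = s *\<^sub>R E"
      with c(1)[OF that] have "s + c * t \<le> s" by (simp add: cc_dist_ray[OF X E \<open>0 \<le> s\<close>])
      then show False using \<open>0 < c\<close> that by (simp add: mult_le_0_iff)
    qed
    then show "\<forall>\<^sub>F t in at_right 0. y t \<in> UNIV \<and> y t \<noteq> s *\<^sub>R E"
      using eventually_at_right_less[of 0] by (auto elim: eventually_mono)
  qed
  then have "((\<lambda>t. \<bar>cc_dist X (y t) 0 - cc_dist X (s *\<^sub>R E) 0 - L (f23_inv (s *\<^sub>R E) \<odot> y t)\<bar> / cc_dist X (s *\<^sub>R E) (y t))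
      \<longlongrightarrow> 0) (at_right 0)"
    by (rule filterlim_compose[OF lim])
  moreover have "\<forall>\<^sub>F t in at_right 0. c / C \<le>
      \<bar>cc_dist X (y t) 0 - cc_dist X (s *\<^sub>R E) 0 - L (f23_inv (s *\<^sub>R E) \<odot> y t)\<bar> / cc_dist X (s *\<^sub>R E) (y t)"
  proof -
    have "c / C \<le> \<bar>cc_dist X (y t) 0 - cc_dist X (s *\<^sub>R E) 0 - L (f23_inv (s *\<^sub>R E) \<odot> y t)\<bar> / cc_dist X (s *\<^sub>R E) (y t)"
      if t: "0 < t" for t
    proof -
      have "f23_inv (s *\<^sub>R E) \<odot> y t = central_shift E t"
        by (simp add: y_def f23_group(2,4) flip: f23_group(1))
      then have L0: "L (f23_inv (s *\<^sub>R E) \<odot> y t) = 0" using G_linear_central[OF L] by simp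
      have pos: "0 < c * t" using \<open>0 < c\<close> t by simp
      have "c / C = (c * t) / (C * t)" using t by simp
      also have "\<dots> \<le> \<bar>cc_dist X (y t) 0 - cc_dist X (s *\<^sub>R E) 0\<bar> / cc_dist X (s *\<^sub>R E) (y t)"
      proof (rule frac_le)
        show "c * t \<le> \<bar>cc_dist X (y t) 0 - cc_dist X (s *\<^sub>R E) 0\<bar>"
          using c(1)[OF t] by (simp add: cc_dist_ray[OF X E \<open>0 \<le> s\<close>])
        show "0 < cc_dist X (s *\<^sub>R E) (y t)" using c(2)[OF t] pos by simp
      qed (use C[OF t] in simp_all)
      finally show ?thesis by (simp add: L0)
    qed
    then show ?thesis by (rule eventually_mono[OF eventually_at_right_less])
  qed
  ultimately have "c / C \<le> 0" by (rule tendsto_lowerbound) simp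
  then show False using \<open>0 < c\<close> \<open>0 < C\<close> by (simp add: divide_le_0_iff)
qed

text \<open>No smaller Lipschitz constant works, as the points \<open>E\<close> and \<open>0\<close> show.\<close>
lemma cc_dist_origin_Lip:
  assumes X: "horizontal_basis X" and E: "E \<in> f23_V1" "norm (horizontal_coords X E) = 1"
  shows "cc_lipschitz_with X 1 (\<lambda>x. cc_dist X x 0)" "cc_Lip X (\<lambda>x. cc_dist X x 0) = 1"
proof -
  have "\<bar>cc_dist X x 0 - cc_dist X y 0\<bar> \<le> cc_dist X x y" for x y
    using cc_dist_triangle[OF X, of x 0 y] cc_dist_triangle[OF X, of y 0 x] cc_dist_sym[of X x y]
    by (simp add: abs_le_iff)
  then show 1: "cc_lipschitz_with X 1 (\<lambda>x. cc_dist X x 0)"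
    by (simp add: cc_lipschitz_with_def)
  have "1 \<le> C" if "cc_lipschitz_with X C (\<lambda>x. cc_dist X x 0)" for C
  proof -
    have "\<bar>cc_dist X E 0 - cc_dist X 0 0\<bar> \<le> C * cc_dist X E 0"
      using that unfolding cc_lipschitz_with_def by blast
    then show ?thesis using cc_dist_ray[OF X E, of 0] cc_dist_ray[OF X E, of 1] by simp
  qed
  with 1 show "cc_Lip X (\<lambda>x. cc_dist X x 0) = 1"
    unfolding cc_Lip_def by (intro cInf_eq_minimum) auto
qed

lemma cc_dist_directional_derivative:
  assumes X: "horizontal_basis X" and E: "E \<in> f23_V1" "norm (horizontal_coords X E) = 1"
  shows "has_directional_derivative (\<lambda>x. cc_dist X x 0) E (f23_exp E) 1"
  unfolding has_directional_derivative_def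
proof (rule tendsto_eventually)
  have "(cc_dist X (f23_exp E \<odot> f23_exp (t *\<^sub>R E)) 0 - cc_dist X (f23_exp E) 0) / t = 1"
    if "t \<noteq> 0" "- 1 < t" for t
  proof -
    have "f23_exp E \<odot> f23_exp (t *\<^sub>R E) = (1 + t) *\<^sub>R E"
      using f23_exp_one_parameter[of 1 E t] by (simp add: f23_exp_def)
    then show ?thesis
      using cc_dist_ray[OF X E, of 1] cc_dist_ray[OF X E, of "1 + t"] that by (simp add: f23_exp_def)
  qed
  then show "\<forall>\<^sub>F t in at 0. (cc_dist X (f23_exp E \<odot> f23_exp (t *\<^sub>R E)) 0 - cc_dist X (f23_exp E) 0) / t = 1"
    unfolding eventually_at by (intro exI[of _ 1]) (auto simp: dist_real_def)
qed

theorem theorem1p2: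
  fixes X :: "2 \<Rightarrow> real^5"
  assumes "horizontal_basis X"
  shows "(\<forall>E\<in>f23_V1. \<not> pansu_differentiable X (\<lambda>x. cc_dist X x 0) (f23_exp E)) \<and>
    (\<forall>E\<in>f23_V1. horizontal_norm X E = 1 \<longrightarrow>
       (\<exists>f x. cc_lipschitz X f \<and> maximal_directional_derivative X f E x \<and>
              \<not> pansu_differentiable X f x))"
proof (intro conjI ballI impI)
  note X = assms
  show nd: "\<not> pansu_differentiable X (\<lambda>x. cc_dist X x 0) (f23_exp E)" if E: "E \<in> f23_V1" for E
  proof -
    obtain U s where "U \<in> f23_V1" "norm (horizontal_coords X U) = 1" "0 \<le> s" "E = s *\<^sub>R U"
    proof (cases "horizontal_coords X E = 0")
      case True
      then have "E = 0 *\<^sub>R X 1" using horizontal_coords_expansion[OF X E] by simp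
      moreover have "norm (horizontal_coords X (X 1)) = 1"
        by (simp add: horizontal_coords_basis[OF X] norm_vec_def L2_set_def UNIV_2)
      ultimately show ?thesis using that[of "X 1" 0] horizontal_basis_in_V1(1)[OF X] by blast
    next
      case False
      define r where "r = norm (horizontal_coords X E)"
      have "r \<noteq> 0" "0 \<le> r" using False by (simp_all add: r_def)
      moreover have "(1 / r) *\<^sub>R E \<in> f23_V1" using E by (simp add: f23_V1_def span_scale)
      moreover have "norm (horizontal_coords X ((1 / r) *\<^sub>R E)) = 1"
        using False by (simp add: horizontal_coords_scaleR r_def)
      ultimately show ?thesis using that[of "(1 / r) *\<^sub>R E" r] by simp
    qed
    then show ?thesis using cc_dist_not_pansu_differentiable[OF X] by (simp add: f23_exp_def)
  qed
  fix E assume E: "E \<in> f23_V1" "horizontal_norm X E = 1"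
  have E1: "norm (horizontal_coords X E) = 1" using E horizontal_norm_eq[OF X E(1)] by simp
  show "\<exists>f x. cc_lipschitz X f \<and> maximal_directional_derivative X f E x \<and> \<not> pansu_differentiable X f x"
  proof (intro exI conjI)
    show "cc_lipschitz X (\<lambda>x. cc_dist X x 0)"
      using cc_dist_origin_Lip(1)[OF X E(1) E1] by (auto simp: cc_lipschitz_def)
    show "maximal_directional_derivative X (\<lambda>x. cc_dist X x 0) E (f23_exp E)"
      using cc_dist_directional_derivative[OF X E(1) E1] cc_dist_origin_Lip(2)[OF X E(1) E1]
      unfolding maximal_directional_derivative_def by (intro exI[of _ 1]) simp
    show "\<not> pansu_differentiable X (\<lambda>x. cc_dist X x 0) (f23_exp E)" by (rule nd[OF E(1)])
  qed
qed

end
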